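(* Let $\mathsf k$ be a field of characteristic $0$ and let $1\le m\le n$. Suppose that $U$ is a Galois $\Gamma$-ring in $\mathcal K=\mathcal L^G=(L*\mathcal M)^G$, where $\mathcal L$ is either $Q_m^n(\mathsf k)$ or $S_m^n(\mathsf k)$. Then $U$ is not a PI-algebra.
   Context: The algebras $S_m^n(\mathsf k)$ and $Q_m^n(\mathsf k)$ are both skew group rings $\mathsf k(x_1,\dots,x_n)*\mathbb Z^m$, where the canonical basis $\varepsilon_1,\dots,\varepsilon_m$ of $\mathbb Z^m$ acts by $\mathsf k$-automorphisms of the field: for $S_m^n(\mathsf k)$, $\varepsilon_i(x_j)=x_j-\delta_{ij}$ if $j\le m$ and $\varepsilon_i(x_j)=x_j$ if $j>m$; for $Q_m^n(\mathsf k)$, $\varepsilon_i(x_j)=q^{\delta_{ij}}x_j$ if $j\le m$ and $\varepsilon_i(x_j)=x_j$ if $j>m$, where $q\in\mathsf k^\times$ is not a root of unity. Setting for Galois rings: $\Lambda$ is an integrally closed (commutative) domain which is a $\mathsf k$-algebra, $G$ is a finite subgroup of the group $\operatorname{Aut}_{\mathsf k}(\Lambda)$ of $\mathsf k$-algebra automorphisms and $\mathcal M$ is a submonoid of $\operatorname{Aut}_{\mathsf k}(\Lambda)$ such that (1) $\mathcal M\mathcal M^{-1}\cap G=\{e\}$; (2) $G$ acts on $\mathcal M$ by conjugation, $g\cdot\mu=g\mu g^{-1}\in\mathcal M$; (3) $\Lambda$ is a Noetherian $\Lambda^G$-module. The monoid $\mathcal M$ is assumed finitely generated. Put $L=\operatorname{Frac}\Lambda$,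 $\Gamma=\Lambda^G$, $K=\operatorname{Frac}\Gamma=L^G$. The skew monoid ring $\mathcal L=L*\mathcal M$ is the free left $L$-module on $\mathcal M$ with multiplication $(a\mu)(b\nu)=a\,\mu(b)\,\mu\nu$. The group $G$ acts on $\mathcal L$ via $a\mu\mapsto g(a)\,(g\cdot\mu)$, and $\mathcal K=\mathcal L^G$ is the fixed ring. (Here $L=\mathsf k(x_1,\dots,x_n)$ and $\mathcal M=\mathbb Z^m$, acting on $L$ either by $\varepsilon_i(x_j)=x_j-\delta_{ij}$ for $j\le m$ and $\varepsilon_i(x_j)=x_j$ for $j>m$, in the case $\mathcal L=S_m^n(\mathsf k)$, or by $\varepsilon_i(x_j)=q^{\delta_{ij}}x_j$ for $j\le m$ and $\varepsilon_i(x_j)=x_j$ for $j>m$, in the case $\mathcal L=Q_m^n(\mathsf k)$.) A Galois $\Gamma$-ring in $\mathcal K$ is a subring $U\subseteq\mathcal K$ containing $\Gamma$ and finitely generated as a ring over $\Gamma$ such that $KU=UK=\mathcal K$. A $\mathsf k$-algebra $A$ is a PI-algebra if there is a polynomial $f(x_1,\dots,x_r)$ in the free associative unital algebra $\mathsf k\langle X\rangle$, having at least one monomial of maximal degree with coefficient $1$, that vanishes under all substitutions of elements of $A$. *)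

theory Defs
  imports
    "HOL-Algebra.Algebraic_Closure_Type"
    "HOL-Algebra.Generated_Rings"
    "HOL-Algebra.Coset"
    "HOL-Algebra.Module"
    "HOL-Library.Poly_Mapping"
    "HOL-Library.Cardinality"
    "HOL-Computational_Algebra.Fraction_Field"
begin

section \<open>Rational functions\<close>

text \<open>The field of rational functions over \<open>'k\<close> in the variables indexed by the type \<open>'n\<close>.
  Exponent vectors are \<open>'n \<Rightarrow>\<^sub>0 nat\<close>, so polynomials are \<open>('n \<Rightarrow>\<^sub>0 nat) \<Rightarrow>\<^sub>0 'k\<close>.\<close>

type_synonym ('n, 'k) ratfun = "(('n \<Rightarrow>\<^sub>0 nat) \<Rightarrow>\<^sub>0 'k) fract"

definition rf_const :: "'k::field \<Rightarrow> ('n::linorder, 'k) ratfun" where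
  "rf_const c = Fract (Poly_Mapping.single 0 c) 1"

definition rf_var :: "'n::linorder \<Rightarrow> ('n, 'k::field) ratfun" where
  "rf_var j = Fract (Poly_Mapping.single (Poly_Mapping.single j 1) 1) 1"

text \<open>A finite linear order is \<open>{1, \<dots>, n}\<close>, \<open>n = CARD('n)\<close>; this is the position of an element.\<close>

definition var_pos :: "'n::{finite, linorder} \<Rightarrow> nat" where
  "var_pos j = card {i. i \<le> j}"


section \<open>Automorphisms\<close>

text \<open>In what follows \<open>\<iota> :: 'k \<Rightarrow> 'l\<close> is the structure map of a \<open>'k\<close>-algebra \<open>'l\<close> which is a field.
  If \<open>\<Lambda>\<close> is a \<open>'k\<close>-subalgebra with field of fractions \<open>'l\<close>, an automorphism of \<open>\<Lambda>\<close> extends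
  uniquely to \<open>'l\<close>; it is represented by this extension, so that automorphisms of \<open>\<Lambda>\<close> are the
  automorphisms of \<open>'l\<close> mapping \<open>\<Lambda>\<close> onto itself.\<close>

definition alg_Aut :: "('k::field \<Rightarrow> 'l::field) \<Rightarrow> 'l set \<Rightarrow> ('l \<Rightarrow> 'l) monoid" where
  "alg_Aut \<iota> \<Lambda> =
    \<lparr>carrier = {\<sigma> \<in> ring_iso ring_of_type_algebra ring_of_type_algebra.
                 (\<forall>c. \<sigma> (\<iota> c) = \<iota> c) \<and> \<sigma> ` \<Lambda> = \<Lambda>},
     monoid.mult = (\<circ>), one = id\<rparr>"

definition conj_aut :: "('l \<Rightarrow> 'l) \<Rightarrow> ('l \<Rightarrow> 'l) \<Rightarrow> 'l \<Rightarrow> 'l" where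
  "conj_aut g \<mu> = g \<circ> \<mu> \<circ> inv_into UNIV g"


section \<open>Skew monoid rings and their fixed rings\<close>

text \<open>The finitely supported function \<open>f\<close> stands for the sum of all \<open>(Poly_Mapping.lookup f \<mu>) \<mu>\<close>.\<close>

definition skew_mult ::
  "(('l \<Rightarrow> 'l) \<Rightarrow>\<^sub>0 'l::field) \<Rightarrow> (('l \<Rightarrow> 'l) \<Rightarrow>\<^sub>0 'l) \<Rightarrow> (('l \<Rightarrow> 'l) \<Rightarrow>\<^sub>0 'l)" where
  "skew_mult f g =
    (\<Sum>\<mu>\<in>Poly_Mapping.keys f. \<Sum>\<nu>\<in>Poly_Mapping.keys g.
       Poly_Mapping.single (\<mu> \<circ> \<nu>) (Poly_Mapping.lookup f \<mu> * \<mu> (Poly_Mapping.lookup g \<nu>)))"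

definition skew_monoid_ring :: "('l \<Rightarrow> 'l) set \<Rightarrow> (('l \<Rightarrow> 'l) \<Rightarrow>\<^sub>0 'l::field) ring" where
  "skew_monoid_ring M =
    \<lparr>carrier = {f. Poly_Mapping.keys f \<subseteq> M}, monoid.mult = skew_mult,
     one = Poly_Mapping.single id 1, ring.zero = 0, add = (+)\<rparr>"

definition skew_scalar :: "'l \<Rightarrow> (('l \<Rightarrow> 'l) \<Rightarrow>\<^sub>0 'l::field)" where
  "skew_scalar a = Poly_Mapping.single id a"

definition skew_act ::
  "('l \<Rightarrow> 'l) \<Rightarrow> (('l \<Rightarrow> 'l) \<Rightarrow>\<^sub>0 'l::field) \<Rightarrow> (('l \<Rightarrow> 'l) \<Rightarrow>\<^sub>0 'l)" where
  "skew_act g f =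
    (\<Sum>\<mu>\<in>Poly_Mapping.keys f. Poly_Mapping.single (conj_aut g \<mu>) (g (Poly_Mapping.lookup f \<mu>)))"

definition skew_fixed_ring ::
  "('l \<Rightarrow> 'l) set \<Rightarrow> ('l \<Rightarrow> 'l) set \<Rightarrow> (('l \<Rightarrow> 'l) \<Rightarrow>\<^sub>0 'l::field) ring" where
  "skew_fixed_ring M G =
    (skew_monoid_ring M)
      \<lparr>carrier := {f \<in> carrier (skew_monoid_ring M). \<forall>g\<in>G. skew_act g f = f}\<rparr>"


section \<open>The setting for Galois rings\<close>

definition integrally_closed :: "'l::field set \<Rightarrow> bool" where
  "integrally_closed \<Lambda> \<longleftrightarrow>
    (\<forall>z. (\<exists>p :: 'l poly. lead_coeff p = 1 \<and> (\<forall>i. Polynomial.coeff p i \<in> \<Lambda>) \<and> poly p z = 0)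
          \<longrightarrow> z \<in> \<Lambda>)"

locale noetherian_module = Module.module +
  assumes submodule_finitely_generated:
    "submodule N R M \<Longrightarrow>
      \<exists>S. finite S \<and> S \<subseteq> carrier M \<and> N = \<Inter> {N'. submodule N' R M \<and> S \<subseteq> N'}"

definition as_module :: "'l::field set \<Rightarrow> ('l, 'l) module" where
  "as_module \<Lambda> =
    \<lparr>carrier = \<Lambda>, monoid.mult = (*), one = 1, ring.zero = 0, add = (+), module.smult = (*)\<rparr>"

definition fixed_points :: "('l \<Rightarrow> 'l) set \<Rightarrow> 'l set \<Rightarrow> 'l set" where
  "fixed_points G \<Lambda> = {a \<in> \<Lambda>. \<forall>g\<in>G. g a = a}"

definition fractions :: "'l::field set \<Rightarrow> 'l set" where
  "fractions \<Gamma> = {a / b | a b. a \<in> \<Gamma> \<and> b \<in> \<Gamma> \<and> b \<noteq> 0}"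

locale galois_setting =
  fixes \<iota> :: "'k::field \<Rightarrow> 'l::field" and \<Lambda> :: "'l set" and G M :: "('l \<Rightarrow> 'l) set"
  assumes structure_map: "\<iota> \<in> ring_hom ring_of_type_algebra ring_of_type_algebra"
    and subring: "subring \<Lambda> ring_of_type_algebra"
    and scalars: "range \<iota> \<subseteq> \<Lambda>"
    and fraction_field: "fractions \<Lambda> = UNIV"
    and integrally_closed: "integrally_closed \<Lambda>"
    and G_subgroup: "subgroup G (alg_Aut \<iota> \<Lambda>)"
    and G_finite: "finite G"
    and M_submonoid: "submonoid M (alg_Aut \<iota> \<Lambda>)"
    and M_finitely_generated:
      "\<exists>S. finite S \<and> S \<subseteq> M \<and> (\<forall>N. submonoid N (alg_Aut \<iota> \<Lambda>) \<and> S \<subseteq> N \<longrightarrow> M \<subseteq> N)"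
    and M_G_separated:
      "(M <#>\<^bsub>alg_Aut \<iota> \<Lambda>\<^esub> set_inv\<^bsub>alg_Aut \<iota> \<Lambda>\<^esub> M) \<inter> G = {id}"
    and conj_closed: "\<And>g \<mu>. g \<in> G \<Longrightarrow> \<mu> \<in> M \<Longrightarrow> conj_aut g \<mu> \<in> M"
    and noetherian:
      "noetherian_module (ring_of_type_algebra\<lparr>carrier := fixed_points G \<Lambda>\<rparr>) (as_module \<Lambda>)"


section \<open>Galois rings\<close>

text \<open>The product of two sets \<open>A\<close>, \<open>B\<close>: all finite sums of products \<open>a b\<close>.\<close>

definition product_span :: "('a, 'b) ring_scheme \<Rightarrow> 'a set \<Rightarrow> 'a set \<Rightarrow> 'a set" where
  "product_span R A B = generate (add_monoid R) (A <#>\<^bsub>R\<^esub> B)"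

text \<open>\<open>galois_ring \<Lambda> G M U\<close>: \<open>U\<close> is a Galois \<open>\<Gamma>\<close>-ring in the fixed ring of the skew monoid ring,
  where \<open>\<Gamma>\<close> is the fixed ring of \<open>\<Lambda>\<close>.\<close>

definition galois_ring ::
  "'l::field set \<Rightarrow> ('l \<Rightarrow> 'l) set \<Rightarrow> ('l \<Rightarrow> 'l) set \<Rightarrow> (('l \<Rightarrow> 'l) \<Rightarrow>\<^sub>0 'l) set \<Rightarrow> bool" where
  "galois_ring \<Lambda> G M U \<longleftrightarrow>
    (let KK = skew_fixed_ring M G;
         \<Gamma> = skew_scalar ` fixed_points G \<Lambda>;
         K = skew_scalar ` fractions (fixed_points G \<Lambda>)
     in subring U KK \<and> \<Gamma> \<subseteq> U \<and>
        (\<exists>S. finite S \<and> S \<subseteq> U \<and> U = generate_ring KK (\<Gamma> \<union> S)) \<and>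
        product_span KK K U = carrier KK \<and> product_span KK U K = carrier KK)"


section \<open>PI-algebras\<close>

text \<open>Elements of the free associative algebra are finite linear combinations of words in the
  variables \<open>0, 1, 2, \<dots>\<close>.  The ring \<open>A\<close> is a \<open>'k\<close>-algebra via \<open>\<iota>\<close>.\<close>

definition free_eval ::
  "('k \<Rightarrow> 'a) \<Rightarrow> ('a, 'b) ring_scheme \<Rightarrow> (nat \<Rightarrow> 'a) \<Rightarrow> (nat list \<Rightarrow>\<^sub>0 'k::field) \<Rightarrow> 'a" where
  "free_eval \<iota> A a f =
    (\<Oplus>\<^bsub>A\<^esub>w\<in>Poly_Mapping.keys f. \<iota> (Poly_Mapping.lookup f w) \<otimes>\<^bsub>A\<^esub> foldr (\<lambda>i b. a i \<otimes>\<^bsub>A\<^esub> b) w \<one>\<^bsub>A\<^esub>)"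

definition PI_algebra :: "('k::field \<Rightarrow> 'a) \<Rightarrow> ('a, 'b) ring_scheme \<Rightarrow> bool" where
  "PI_algebra \<iota> A \<longleftrightarrow>
    (\<exists>f :: nat list \<Rightarrow>\<^sub>0 'k.
       (\<exists>w\<in>Poly_Mapping.keys f.
          Poly_Mapping.lookup f w = 1 \<and> (\<forall>v\<in>Poly_Mapping.keys f. length v \<le> length w)) \<and>
       (\<forall>a. (\<forall>i. a i \<in> carrier A) \<longrightarrow> free_eval \<iota> A a f = \<zero>\<^bsub>A\<^esub>))"


section \<open>The two skew group rings\<close>

text \<open>The group \<open>\<int>\<^sup>m\<close> acts faithfully on the rational functions in both cases (for \<open>Q_alg\<close>
  because \<open>q\<close> is not a root of unity, for \<open>S_alg\<close> because of characteristic \<open>0\<close>), and is identified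
  with the group of automorphisms generated by the images of its canonical basis.  The
  automorphisms in the generating sets are determined by their values at the variables.\<close>

definition shift_group ::
  "nat \<Rightarrow> (('n::{finite, linorder}, 'k::field) ratfun \<Rightarrow> ('n, 'k) ratfun) set" where
  "shift_group m =
    generate (alg_Aut rf_const UNIV)
      {\<epsilon> \<in> carrier (alg_Aut rf_const UNIV).
         \<exists>i. var_pos i \<le> m \<and> (\<forall>j. \<epsilon> (rf_var j) = (if j = i then rf_var j - 1 else rf_var j))}"

definition qshift_group ::
  "'k \<Rightarrow> nat \<Rightarrow> (('n::{finite, linorder}, 'k::field) ratfun \<Rightarrow> ('n, 'k) ratfun) set" where
  "qshift_group q m =
    generate (alg_Aut rf_const UNIV)
      {\<epsilon> \<in> carrier (alg_Aut rf_const UNIV).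
         \<exists>i. var_pos i \<le> m \<and>
             (\<forall>j. \<epsilon> (rf_var j) = (if j = i then rf_const q * rf_var j else rf_var j))}"

definition S_alg ::
  "nat \<Rightarrow> ((('n::{finite, linorder}, 'k::field) ratfun \<Rightarrow> ('n, 'k) ratfun) \<Rightarrow>\<^sub>0 ('n, 'k) ratfun) ring"
  where "S_alg m = skew_monoid_ring (shift_group m)"

definition Q_alg ::
  "'k \<Rightarrow> nat \<Rightarrow>
    ((('n::{finite, linorder}, 'k::field) ratfun \<Rightarrow> ('n, 'k) ratfun) \<Rightarrow>\<^sub>0 ('n, 'k) ratfun) ring"
  where "Q_alg q m = skew_monoid_ring (qshift_group q m)"

end

theory Submission
  imports Defs
begin

text \<open>Choose \<open>u\<close> in \<open>U\<close> with a nontrivial automorphism in its support, and \<open>\<mu>\<close> in the support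
  whose exponent vector in \<open>\<int>\<^sup>m\<close> has maximal Euclidean norm.  The inner product with this vector
  is a weight for which \<open>\<mu>\<close> is the leading term of \<open>u\<close>.  If \<open>f\<close> is a polynomial identity of degree
  \<open>d\<close>, substitute \<open>\<gamma>\<^sub>i u\<close> with \<open>\<gamma>\<^sub>i\<close> in \<open>\<Gamma>\<close> for the variables; comparing coefficients at the \<open>d\<close>-th power
  of \<open>\<mu>\<close> shows that the sum over the words \<open>w\<close> of length \<open>d\<close> of the coefficients \<open>f\<^sub>w\<close>, multiplied
  by the product of the \<open>\<mu>\<^sup>j(\<gamma>\<^bsub>w j\<^esub>)\<close>, vanishes.
  Some \<open>\<gamma>\<close> in \<open>\<Gamma>\<close> has an infinite orbit under \<open>\<mu>\<close>.  Let \<open>\<gamma>\<^sub>i\<close> be polynomials in \<open>\<gamma>\<close> with constant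
  coefficients: since the constants are infinite in number, the relation persists when their
  coefficients are taken from the field of rational functions, and Lagrange interpolation at
  the distinct points \<open>\<mu>\<^sup>j(\<gamma>)\<close> isolates each \<open>f\<^sub>w\<close>.\<close>

section \<open>Field automorphisms\<close>

locale field_aut =
  fixes \<sigma> :: "'l::field \<Rightarrow> 'l"
  assumes bij: "bij \<sigma>"
    and one [simp]: "\<sigma> 1 = 1"
    and add: "\<sigma> (x + y) = \<sigma> x + \<sigma> y"
    and mult: "\<sigma> (x * y) = \<sigma> x * \<sigma> y"
begin

lemma inj: "inj \<sigma>"
  using bij by (simp add: bij_def)

lemma zero [simp]: "\<sigma> 0 = 0"
proof -
  have "\<sigma> 0 + \<sigma> 0 = \<sigma> 0"
    using add[of 0 0] by simp
  then show ?thesis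
    by (simp only: add_cancel_left_right)
qed

lemma eq_iff [simp]: "\<sigma> x = \<sigma> y \<longleftrightarrow> x = y"
  using inj by (auto dest: injD)

lemma eq_0_iff [simp]: "\<sigma> x = 0 \<longleftrightarrow> x = 0"
  using eq_iff[of x 0] by (simp del: eq_iff)

lemma minus: "\<sigma> (- x) = - \<sigma> x"
  using add[of x "- x"] by (simp add: eq_neg_iff_add_eq_0 add.commute)

lemma diff: "\<sigma> (x - y) = \<sigma> x - \<sigma> y"
  using add[of x "- y"] by (simp add: minus)

lemma inverse: "\<sigma> (inverse x) = inverse (\<sigma> x)"
proof (cases "x = 0")
  case False
  then have "\<sigma> x * \<sigma> (inverse x) = 1"
    by (simp flip: mult)
  then show ?thesis
    by (simp add: inverse_unique)
qed auto

lemma divide: "\<sigma> (x / y) = \<sigma> x / \<sigma> y"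
  by (simp add: field_class.field_divide_inverse mult inverse)

lemma power: "\<sigma> (x ^ n) = \<sigma> x ^ n"
  by (induction n) (auto simp: mult)

lemma sum: "\<sigma> (sum f A) = (\<Sum>x\<in>A. \<sigma> (f x))"
  by (induction A rule: infinite_finite_induct) (auto simp: add)

lemma prod: "\<sigma> (prod f A) = (\<Prod>x\<in>A. \<sigma> (f x))"
  by (induction A rule: infinite_finite_induct) (auto simp: mult)

lemma inv: "field_aut (inv_into UNIV \<sigma>)"
proof
  have *: "\<sigma> (inv_into UNIV \<sigma> x) = x" for x
    using bij by (simp add: bij_is_surj surj_f_inv_f)
  show "bij (inv_into UNIV \<sigma>)"
    using bij by (rule bij_imp_bij_inv)
  show "inv_into UNIV \<sigma> 1 = 1"
    by (rule inv_f_eq[OF inj]) simp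
  show "inv_into UNIV \<sigma> (x + y) = inv_into UNIV \<sigma> x + inv_into UNIV \<sigma> y" for x y
    by (rule inv_f_eq[OF inj]) (simp add: add *)
  show "inv_into UNIV \<sigma> (x * y) = inv_into UNIV \<sigma> x * inv_into UNIV \<sigma> y" for x y
    by (rule inv_f_eq[OF inj]) (simp add: mult *)
qed

end

lemma field_aut_comp:
  assumes "field_aut \<sigma>" "field_aut \<tau>"
  shows "field_aut (\<sigma> \<circ> \<tau>)"
proof -
  interpret \<sigma>: field_aut \<sigma> by fact
  interpret \<tau>: field_aut \<tau> by fact
  show ?thesis
    by unfold_locales (auto simp: \<sigma>.bij \<tau>.bij bij_comp \<sigma>.add \<tau>.add \<sigma>.mult \<tau>.mult)
qed

lemma field_aut_id: "field_aut id"
  by unfold_locales auto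

lemma field_aut_funpow: "field_aut \<sigma> \<Longrightarrow> field_aut (\<sigma> ^^ n)"
  by (induction n) (auto intro: field_aut_id field_aut_comp)

lemma carrier_alg_Aut:
  "carrier (alg_Aut \<iota> \<Lambda>) = {\<sigma>. field_aut \<sigma> \<and> (\<forall>c. \<sigma> (\<iota> c) = \<iota> c) \<and> \<sigma> ` \<Lambda> = \<Lambda>}"
  by (auto simp: alg_Aut_def ring_iso_def ring_hom_def ring_of_type_algebra_def field_aut_def)

lemma alg_Aut_simps [simp]:
  "monoid.mult (alg_Aut \<iota> \<Lambda>) = (\<circ>)" "one (alg_Aut \<iota> \<Lambda>) = id"
  by (simp_all add: alg_Aut_def)

text \<open>\<open>generate\<close> closes under \<open>m_inv\<close>, a definite description over
  the carrier. The inverse function lies in the carrier since it fixes the constants and is onto;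
  associativity of composition makes it unique.\<close>

lemma m_inv_alg_Aut_UNIV:
  assumes "\<sigma> \<in> carrier (alg_Aut \<iota> UNIV)"
  shows "inv\<^bsub>alg_Aut \<iota> UNIV\<^esub> \<sigma> = inv_into UNIV \<sigma>"
proof -
  from assms interpret field_aut \<sigma>
    by (simp add: carrier_alg_Aut)
  have "inv_into UNIV \<sigma> (\<iota> c) = \<iota> c" for c
    using assms by (intro inv_f_eq inj) (simp add: carrier_alg_Aut)
  then have car: "inv_into UNIV \<sigma> \<in> carrier (alg_Aut \<iota> UNIV)"
    using inv by (auto simp: carrier_alg_Aut field_aut.bij bij_is_surj)
  have l: "\<sigma> \<circ> inv_into UNIV \<sigma> = id" and r: "inv_into UNIV \<sigma> \<circ> \<sigma> = id"
    using bij by (auto simp: fun_eq_iff bij_is_surj surj_f_inv_f inj)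
  show ?thesis
    unfolding m_inv_def alg_Aut_simps
  proof (rule the_equality)
    fix \<tau> assume "\<tau> \<in> carrier (alg_Aut \<iota> UNIV) \<and> \<sigma> \<circ> \<tau> = id \<and> \<tau> \<circ> \<sigma> = id"
    then show "\<tau> = inv_into UNIV \<sigma>"
      by (metis comp_assoc comp_id id_comp l)
  qed (use car l r in auto)
qed


section \<open>Rational functions\<close>

lemma inj_rf_const: "inj (rf_const :: 'k::field \<Rightarrow> ('n::linorder, 'k) ratfun)"
  by (rule injI) (auto simp: rf_const_def eq_fract dest: injD[OF inj_single])

lemma rf_const_add: "rf_const (a + b) = rf_const a + rf_const b"
  by (simp add: rf_const_def single_add)

lemma rf_const_mult: "rf_const (a * b) = rf_const a * rf_const b"
  by (simp add: rf_const_def mult_single)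

lemma rf_const_0 [simp]: "rf_const 0 = 0"
  by (simp add: rf_const_def fract_collapse)

lemma rf_const_1 [simp]: "rf_const 1 = 1"
  by (simp add: rf_const_def fract_collapse)

lemma rf_const_eq_iff [simp]:
  "(rf_const a :: ('n::linorder, 'k::field) ratfun) = rf_const b \<longleftrightarrow> a = b"
  using inj_rf_const by (auto dest: injD)

section \<open>Substitution homomorphisms of the polynomial ring\<close>

definition mpoly_var :: "'n::linorder \<Rightarrow> ('n \<Rightarrow>\<^sub>0 nat) \<Rightarrow>\<^sub>0 'k::field" where
  "mpoly_var j = Poly_Mapping.single (Poly_Mapping.single j 1) 1"

abbreviation mpoly_const :: "'k::field \<Rightarrow> ('n::linorder \<Rightarrow>\<^sub>0 nat) \<Rightarrow>\<^sub>0 'k" where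
  "mpoly_const \<equiv> Poly_Mapping.single 0"

lemma mpoly_const_mult: "mpoly_const (a * b) = mpoly_const a * mpoly_const b"
  by (simp add: mult_single)

lemma poly_mapping_eq_sum_single:
  "p = (\<Sum>k\<in>Poly_Mapping.keys p. Poly_Mapping.single k (Poly_Mapping.lookup p k))"
proof (rule poly_mapping_eqI)
  fix k
  show "Poly_Mapping.lookup p k
      = Poly_Mapping.lookup (\<Sum>k\<in>Poly_Mapping.keys p. Poly_Mapping.single k (Poly_Mapping.lookup p k)) k"
    by (simp add: lookup_sum lookup_single when_def in_keys_iff)
qed

lemma mpoly_var_power:
  "mpoly_var j ^ e = Poly_Mapping.single (Poly_Mapping.single j e) 1"
  by (induction e) (simp_all add: mpoly_var_def mult_single flip: single_add)

lemma prod_single_one: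
  "finite A \<Longrightarrow> (\<Prod>i\<in>A. Poly_Mapping.single (f i) (1::'k::field)) = Poly_Mapping.single (\<Sum>i\<in>A. f i) 1"
  for f :: "'a \<Rightarrow> 'n::linorder \<Rightarrow>\<^sub>0 nat"
  by (induction A rule: finite_induct) (simp_all add: mult_single)

lemma single_eq_monomial:
  fixes e :: "'n::{finite, linorder} \<Rightarrow>\<^sub>0 nat"
  shows "Poly_Mapping.single e c = mpoly_const c * (\<Prod>i\<in>UNIV. mpoly_var i ^ Poly_Mapping.lookup e i)"
proof -
  have "(\<Sum>i\<in>UNIV. Poly_Mapping.single i (Poly_Mapping.lookup e i)) = e"
    by (rule poly_mapping_eqI) (simp add: lookup_sum lookup_single when_def)
  then show ?thesis
    by (simp add: mpoly_var_power prod_single_one mult_single)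
qed

text \<open>Every monomial is a constant times powers of variables. The target is an arbitrary
  commutative ring, so as to cover both endomorphisms of the polynomial ring and restrictions of
  maps of its fraction field.\<close>

lemma mpoly_hom_eqI:
  fixes S T :: "(('n::{finite, linorder} \<Rightarrow>\<^sub>0 nat) \<Rightarrow>\<^sub>0 'k::field) \<Rightarrow> 'a::comm_ring_1"
  assumes "\<And>p q. S (p + q) = S p + S q" "\<And>p q. S (p * q) = S p * S q" "S 1 = 1"
    and "\<And>p q. T (p + q) = T p + T q" "\<And>p q. T (p * q) = T p * T q" "T 1 = 1"
    and "\<And>c. S (mpoly_const c) = T (mpoly_const c)" "\<And>j. S (mpoly_var j) = T (mpoly_var j)"
  shows "S p = T p"
proof -
  have sum: "H (sum f A) = (\<Sum>x\<in>A. H (f x))" if "\<And>p q. H (p + q) = H p + H q"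
    for H :: "(('n \<Rightarrow>\<^sub>0 nat) \<Rightarrow>\<^sub>0 'k) \<Rightarrow> 'a" and f and A :: "('n \<Rightarrow>\<^sub>0 nat) set"
    using that[of 0 0] by (induction A rule: infinite_finite_induct) (auto simp: that)
  have prod: "H (prod f A) = (\<Prod>x\<in>A. H (f x))" if "\<And>p q. H (p * q) = H p * H q" "H 1 = 1"
    for H :: "(('n \<Rightarrow>\<^sub>0 nat) \<Rightarrow>\<^sub>0 'k) \<Rightarrow> 'a" and f and A :: "'n set"
    by (induction A rule: infinite_finite_induct) (auto simp: that)
  have power: "H (f ^ n) = H f ^ n" if "\<And>p q. H (p * q) = H p * H q" "H 1 = 1"
    for H :: "(('n \<Rightarrow>\<^sub>0 nat) \<Rightarrow>\<^sub>0 'k) \<Rightarrow> 'a" and f n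
    by (induction n) (auto simp: that)
  have "S (Poly_Mapping.single e c) = T (Poly_Mapping.single e c)" for e c
    by (subst (1 2) single_eq_monomial) (simp add: assms prod[of S] prod[of T] power[of S] power[of T])
  then show ?thesis
    by (subst (1 2) poly_mapping_eq_sum_single[of p]) (simp add: sum[of S] sum[of T] assms(1,4))
qed

definition mpoly_subst ::
  "('n::{finite, linorder} \<Rightarrow> ('n \<Rightarrow>\<^sub>0 nat) \<Rightarrow>\<^sub>0 'k::field) \<Rightarrow>
    (('n \<Rightarrow>\<^sub>0 nat) \<Rightarrow>\<^sub>0 'k) \<Rightarrow> ('n \<Rightarrow>\<^sub>0 nat) \<Rightarrow>\<^sub>0 'k" where
  "mpoly_subst h p =
    (\<Sum>e\<in>Poly_Mapping.keys p.
       mpoly_const (Poly_Mapping.lookup p e) * (\<Prod>i\<in>UNIV. h i ^ Poly_Mapping.lookup e i))"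

text \<open>Exponents outside the support contribute 0, so two polynomials can be summed over a
  common index set.\<close>

lemma mpoly_subst_eq_sum:
  assumes "finite A" "Poly_Mapping.keys p \<subseteq> A"
  shows "mpoly_subst h p =
    (\<Sum>e\<in>A. mpoly_const (Poly_Mapping.lookup p e) * (\<Prod>i\<in>UNIV. h i ^ Poly_Mapping.lookup e i))"
  unfolding mpoly_subst_def
  by (rule sum.mono_neutral_left) (use assms in \<open>auto simp: in_keys_iff\<close>)

lemma mpoly_subst_add: "mpoly_subst h (p + q) = mpoly_subst h p + mpoly_subst h q"
proof -
  let ?A = "Poly_Mapping.keys p \<union> Poly_Mapping.keys q"
  have "finite ?A" "Poly_Mapping.keys (p + q) \<subseteq> ?A"
    by (auto simp: keys_add)
  then show ?thesis
    by (simp add: mpoly_subst_eq_sum[of ?A] lookup_add single_add algebra_simps sum.distrib)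
qed

lemma mpoly_subst_single:
  "mpoly_subst h (Poly_Mapping.single e c) = mpoly_const c * (\<Prod>i\<in>UNIV. h i ^ Poly_Mapping.lookup e i)"
  by (simp add: mpoly_subst_eq_sum[of "{e}"])

lemma mpoly_subst_const: "mpoly_subst h (mpoly_const c) = mpoly_const c"
  by (simp add: mpoly_subst_single)

lemma mpoly_subst_one: "mpoly_subst h 1 = 1"
  using mpoly_subst_const[of h 1] by simp

lemma mpoly_subst_var: "mpoly_subst h (mpoly_var j) = h j"
proof -
  have "h i ^ Poly_Mapping.lookup (Poly_Mapping.single j 1) i = (if i = j then h i else 1)" for i
    by (simp add: lookup_single when_def)
  then show ?thesis
    by (simp add: mpoly_var_def mpoly_subst_single)
qed

lemma mpoly_subst_sum: "mpoly_subst h (sum f A) = (\<Sum>x\<in>A. mpoly_subst h (f x))"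
  by (induction A rule: infinite_finite_induct)
    (auto simp: mpoly_subst_add, simp_all add: mpoly_subst_def)

text \<open>Both sides are additive in each argument, which leaves the product of two
  monomials.\<close>

lemma mpoly_subst_mult: "mpoly_subst h (p * q) = mpoly_subst h p * mpoly_subst h q"
proof -
  have single: "mpoly_subst h (Poly_Mapping.single e c * Poly_Mapping.single e' c')
    = mpoly_subst h (Poly_Mapping.single e c) * mpoly_subst h (Poly_Mapping.single e' c')" for e e' c c'
    unfolding mult_single mpoly_subst_single lookup_add power_add prod.distrib
    by (simp only: mpoly_const_mult mult.assoc mult.left_commute)
  show ?thesis
    by (subst (1 2) poly_mapping_eq_sum_single[of p], subst (1 2) poly_mapping_eq_sum_single[of q])
      (simp add: sum_product mpoly_subst_sum single)
qed

section \<open>Extension of automorphisms to the field of fractions\<close>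

definition fract_map :: "('a::idom \<Rightarrow> 'a) \<Rightarrow> 'a fract \<Rightarrow> 'a fract" where
  "fract_map E x = (case SOME (a, b). b \<noteq> 0 \<and> x = Fract a b of (a, b) \<Rightarrow> Fract (E a) (E b))"

text \<open>The representative picked by \<open>SOME\<close> does not matter: a multiplicative
  \<open>E\<close> preserves the cross-multiplied equation, and it keeps denominators
  nonzero.\<close>

lemma fract_map_Fract:
  assumes "\<And>p q. E (p * q) = E p * E q" "\<And>p. E p = 0 \<longleftrightarrow> p = 0" "b \<noteq> 0"
  shows "fract_map E (Fract a b) = Fract (E a) (E b)"
proof -
  let ?P = "\<lambda>(a', b'). b' \<noteq> 0 \<and> Fract a b = Fract a' b'"
  obtain a' b' where some: "Eps ?P = (a', b')"
    by fastforce
  have "?P (Eps ?P)"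
    by (rule someI[of ?P "(a, b)"]) (use assms in auto)
  with some have *: "b' \<noteq> 0" "Fract a b = Fract a' b'"
    by auto
  then have "E a * E b' = E a' * E b"
    using assms by (simp add: eq_fract flip: assms(1))
  with * show ?thesis
    using assms some by (simp add: fract_map_def eq_fract)
qed

lemma field_aut_fract_map:
  assumes add: "\<And>p q. E (p + q) = E p + E q" and mult: "\<And>p q. E (p * q) = E p * E q"
    and one: "E 1 = 1" and "bij E"
  shows "field_aut (fract_map E)"
proof -
  have "E 0 + E 0 = E 0"
    using add[of 0 0] by simp
  then have E0: "E 0 = 0"
    by (simp only: add_cancel_left_right)
  have inj: "E p = E q \<longleftrightarrow> p = q" for p q
    using \<open>bij E\<close> by (auto dest: bij_is_inj injD)
  then have z: "E p = 0 \<longleftrightarrow> p = 0" for p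
    using E0 inj[of p 0] by simp
  note F = fract_map_Fract[of E, OF mult z]
  show ?thesis
  proof
    show "fract_map E 1 = 1"
      by (simp add: One_fract_def F one)
    show "fract_map E (x + y) = fract_map E x + fract_map E y" for x y
      by (cases x; cases y) (simp add: F z add mult)
    show "fract_map E (x * y) = fract_map E x * fract_map E y" for x y
      by (cases x; cases y) (simp add: F z add mult)
    show "bij (fract_map E)"
    proof (rule bijI)
      show "inj (fract_map E)"
      proof (rule injI)
        fix x y assume "fract_map E x = fract_map E y"
        then show "x = y"
          by (cases x; cases y) (simp add: F z eq_fract inj flip: mult)
      qed
      show "surj (fract_map E)"
        unfolding surj_def
      proof
        fix y
        show "\<exists>x. y = fract_map E x"
        proof (cases y)
          case (Fract a b)
          moreover obtain a' b' where "a = E a'" "b = E b'"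
            using \<open>bij E\<close> by (metis bij_is_surj surjD)
          ultimately have "y = fract_map E (Fract a' b')"
            by (simp add: F z)
          then show ?thesis ..
        qed
      qed
    qed
  qed
qed

text \<open>Agreement passes from constants and variables to polynomials by
  \<open>mpoly_hom_eqI\<close>, and then to quotients.\<close>

lemma ratfun_aut_eqI:
  fixes \<sigma> \<tau> :: "('n::{finite, linorder}, 'k::field) ratfun \<Rightarrow> ('n, 'k) ratfun"
  assumes "field_aut \<sigma>" "field_aut \<tau>"
    and "\<And>c. \<sigma> (rf_const c) = \<tau> (rf_const c)" "\<And>j. \<sigma> (rf_var j) = \<tau> (rf_var j)"
  shows "\<sigma> = \<tau>"
proof
  fix x
  interpret \<sigma>: field_aut \<sigma> by fact
  interpret \<tau>: field_aut \<tau> by fact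
  have *: "\<sigma> (Fract p 1) = \<tau> (Fract p 1)" for p
  proof (rule mpoly_hom_eqI[of "\<lambda>p. \<sigma> (Fract p 1)" "\<lambda>p. \<tau> (Fract p 1)"])
    have a: "Fract (p + q) 1 = Fract p 1 + Fract q 1" for p q :: "('n \<Rightarrow>\<^sub>0 nat) \<Rightarrow>\<^sub>0 'k"
      by simp
    have m: "Fract (p * q) 1 = Fract p 1 * Fract q 1" for p q :: "('n \<Rightarrow>\<^sub>0 nat) \<Rightarrow>\<^sub>0 'k"
      by simp
    show "\<sigma> (Fract (p + q) 1) = \<sigma> (Fract p 1) + \<sigma> (Fract q 1)"
      and "\<tau> (Fract (p + q) 1) = \<tau> (Fract p 1) + \<tau> (Fract q 1)"
      and "\<sigma> (Fract (p * q) 1) = \<sigma> (Fract p 1) * \<sigma> (Fract q 1)"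
      and "\<tau> (Fract (p * q) 1) = \<tau> (Fract p 1) * \<tau> (Fract q 1)" for p q
      by (simp_all only: a m \<sigma>.add \<tau>.add \<sigma>.mult \<tau>.mult)
    show "\<sigma> (Fract 1 1) = 1" "\<tau> (Fract 1 1) = 1"
      by (simp_all add: fract_collapse)
    show "\<sigma> (Fract (mpoly_const c) 1) = \<tau> (Fract (mpoly_const c) 1)" for c
      using assms(3)[of c] by (simp add: rf_const_def)
    show "\<sigma> (Fract (mpoly_var j) 1) = \<tau> (Fract (mpoly_var j) 1)" for j
      using assms(4)[of j] by (simp add: rf_var_def mpoly_var_def)
  qed
  show "\<sigma> x = \<tau> x"
  proof (cases x)
    case (Fract a b)
    then have "x = Fract a 1 / Fract b 1"
      by simp
    then show ?thesis
      by (simp only: \<sigma>.divide \<tau>.divide *)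
  qed
qed

text \<open>Both composites of the two substitutions fix variables and constants, hence are the
  identity; the automorphism of the polynomial ring obtained in this way extends to fractions. This
  produces the basis automorphisms of both actions.\<close>

lemma exists_ratfun_aut:
  fixes h h' :: "'n::{finite, linorder} \<Rightarrow> ('n \<Rightarrow>\<^sub>0 nat) \<Rightarrow>\<^sub>0 'k::field"
  assumes "\<And>j. mpoly_subst h (h' j) = mpoly_var j" "\<And>j. mpoly_subst h' (h j) = mpoly_var j"
  obtains \<epsilon> where "\<epsilon> \<in> carrier (alg_Aut rf_const UNIV)" "\<And>j. \<epsilon> (rf_var j) = Fract (h j) 1"
proof -
  have inverse: "mpoly_subst g (mpoly_subst g' p) = p"
    if "\<And>j. mpoly_subst g (g' j) = mpoly_var j" for g g' and p :: "('n \<Rightarrow>\<^sub>0 nat) \<Rightarrow>\<^sub>0 'k"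
    by (rule mpoly_hom_eqI[of "\<lambda>p. mpoly_subst g (mpoly_subst g' p)" "\<lambda>p. p"])
      (simp_all add: mpoly_subst_add mpoly_subst_mult mpoly_subst_one mpoly_subst_const
        mpoly_subst_var that)
  have "bij (mpoly_subst h)"
    by (rule o_bij[of "mpoly_subst h'"]) (auto simp: fun_eq_iff inverse assms)
  then have aut: "field_aut (fract_map (mpoly_subst h))"
    by (intro field_aut_fract_map mpoly_subst_add mpoly_subst_mult mpoly_subst_one)
  have F: "fract_map (mpoly_subst h) (Fract p 1) = Fract (mpoly_subst h p) 1" for p
  proof -
    have "mpoly_subst h p = 0 \<longleftrightarrow> p = 0" for p
    proof
      assume "mpoly_subst h p = 0"
      then have "mpoly_subst h' (mpoly_subst h p) = 0"
        by (simp add: mpoly_subst_def)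
      then show "p = 0"
        by (simp add: inverse assms)
    qed (simp add: mpoly_subst_def)
    from fract_map_Fract[of "mpoly_subst h", OF mpoly_subst_mult this, of 1 p]
    show ?thesis
      by (simp add: mpoly_subst_one)
  qed
  show ?thesis
  proof (rule that)
    show "fract_map (mpoly_subst h) \<in> carrier (alg_Aut rf_const UNIV)"
      using aut by (auto simp: carrier_alg_Aut F rf_const_def mpoly_subst_const
          field_aut.bij bij_is_surj)
    show "fract_map (mpoly_subst h) (rf_var j) = Fract (h j) 1" for j
      using F[of "mpoly_var j"] mpoly_subst_var[of h j] by (simp add: rf_var_def mpoly_var_def)
  qed
qed


section \<open>Evaluation of words\<close>

text \<open>Coordinates are freed from \<open>C\<close> one at a time: in each coordinate
  \<open>F\<close> is a polynomial with infinitely many zeros. The finite set \<open>S\<close>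
  collects the coordinates already freed.\<close>

lemma separately_polynomial_vanish:
  fixes F :: "('i \<Rightarrow> 'a::idom) \<Rightarrow> 'a"
  assumes poly: "\<And>c x. \<exists>P. \<forall>z. F (c(x := z)) = poly P z"
    and "infinite C" and zero: "\<And>c. \<forall>x. c x \<in> C \<Longrightarrow> F c = 0"
    and "finite S" "\<forall>x. x \<notin> S \<longrightarrow> c x \<in> C"
  shows "F c = 0"
  using assms(4,5)
proof (induction S arbitrary: c rule: finite_induct)
  case empty
  then show ?case
    by (simp add: zero)
next
  case (insert x S)
  obtain P where P: "F (c(x := z)) = poly P z" for z
    using poly by blast
  have "poly P z = 0" if "z \<in> C" for z
    unfolding P[symmetric] by (rule insert.IH) (use insert.prems that in auto)
  then have "C \<subseteq> {z. poly P z = 0}"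
    by auto
  with \<open>infinite C\<close> have "P = 0"
    using poly_roots_finite finite_subset by metis
  then show ?case
    using P[of "c x"] by simp
qed

lemma exists_lagrange_basis:
  fixes t :: "nat \<Rightarrow> 'a::field"
  assumes "inj_on t {..<d}" "j < d"
  obtains p where "degree p < d" "\<And>i. i < d \<Longrightarrow> poly p (t i) = (if i = j then 1 else 0)"
proof
  let ?J = "{..<d} - {j}"
  let ?q = "\<Prod>i\<in>?J. [:- t i, 1:]"
  let ?p = "smult (inverse (poly ?q (t j))) ?q"
  have "degree ?q \<le> sum (degree \<circ> (\<lambda>i. [:- t i, 1:])) ?J"
    by (rule degree_prod_sum_le) simp
  also have "\<dots> < d"
    using assms(2) by simp
  finally show "degree ?p < d"
    by (rule le_less_trans[OF degree_smult_le])
  have "poly ?q (t j) \<noteq> 0"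
    using assms by (auto simp: poly_prod dest: inj_onD)
  then show "poly ?p (t i) = (if i = j then 1 else 0)" if "i < d" for i
    using that by (auto simp: poly_prod)
qed

text \<open>Extending the scalars from \<open>C\<close> to the whole field allows interpolation at the points \<open>t j\<close>,
  which need not be possible with coefficients from \<open>C\<close>.\<close>

lemma word_coefficients_vanish:
  fixes t :: "nat \<Rightarrow> 'a::field"
  assumes "finite W" and len: "\<And>w. w \<in> W \<Longrightarrow> length w = d"
    and inj: "inj_on t {..<d}" and C: "infinite C" "0 \<in> C"
    and zero: "\<And>c. \<forall>x. c x \<in> C \<Longrightarrow>
      (\<Sum>w\<in>W. a w * (\<Prod>j<d. \<Sum>l<d. c (w ! j :: nat, l) * t j ^ l)) = 0"
    and w0: "w0 \<in> W"
  shows "a w0 = 0"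
proof -
  define F where "F c = (\<Sum>w\<in>W. a w * (\<Prod>j<d. \<Sum>l<d. c (w ! j :: nat, l) * t j ^ l))" for c
  have "\<exists>P. \<forall>z. F (c(x := z)) = poly P z" for c x
  proof -
    \<comment> \<open>The entry of \<open>c\<close> at \<open>x\<close> becomes the indeterminate,
      all others stay constants.\<close>
    let ?P = "\<Sum>w\<in>W. [:a w:] * (\<Prod>j<d. \<Sum>l<d. (if (w ! j, l) = x then [:0, t j ^ l:] else [:c (w ! j, l) * t j ^ l:]))"
    have *: "(c(x := z)) (i, l) * y = poly (if (i, l) = x then [:0, y:] else [:c (i, l) * y:]) z" for z i l y
      by simp
    have "F (c(x := z)) = poly ?P z" for z
      unfolding F_def poly_sum poly_mult poly_prod * by simp
    then show ?thesis
      by blast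
  qed
  note vanish = separately_polynomial_vanish[of F C, OF this C(1)]
  have "\<exists>p. degree p < d \<and> (\<forall>i<d. poly p (t i) = (if i = j then 1 else 0))" if "j < d" for j
    using exists_lagrange_basis[OF inj that] by metis
  then obtain e where deg: "\<And>j. j < d \<Longrightarrow> degree (e j) < d"
    and e: "\<And>i j. i < d \<Longrightarrow> j < d \<Longrightarrow> poly (e j) (t i) = (if i = j then 1 else 0)"
    by metis
  \<comment> \<open>The positions at which \<open>w0\<close> has the letter \<open>i\<close> are the
    points at which \<open>p i\<close> takes the value 1; at the other \<open>t j\<close> it is
    0.\<close>
  define p where "p i = (\<Sum>j | j < d \<and> w0 ! j = i. e j)" for i
  have p_eval: "poly (p i) (t j) = (if w0 ! j = i then 1 else 0)" if "j < d" for i j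
    using that by (auto simp: p_def poly_sum e if_distrib sum.If_cases)
  have p_coeff: "coeff (p i) l = 0" if "l \<ge> d" for i l
    using that deg by (auto simp: p_def coeff_sum intro!: sum.neutral coeff_eq_0 intro: less_le_trans)
  have sum_coeff: "(\<Sum>l<d. coeff (p i) l * x ^ l) = poly (p i) x" for i x
    unfolding poly_altdef
    by (rule sum.mono_neutral_cong)
      (use p_coeff in \<open>auto simp: coeff_eq_0 not_le not_less\<close>)
  \<comment> \<open>Letters absent from \<open>w0\<close> get the zero polynomial, so, as 0 lies in
    \<open>C\<close>, only finitely many coefficients can lie outside \<open>C\<close>.\<close>
  have p_0: "p i = 0" if "i \<notin> set w0" for i
  proof -
    have "{j. j < d \<and> w0 ! j = i} = {}"
      using that len[OF w0] by auto
    then show ?thesis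
      by (simp only: p_def sum.empty)
  qed
  have "F (\<lambda>(i, l). coeff (p i) l) = 0"
  proof (rule vanish)
    show "F c = 0" if "\<forall>x. c x \<in> C" for c
      using zero[OF that] by (simp add: F_def)
    show "finite (set w0 \<times> {..<d})"
      by simp
    show "\<forall>x. x \<notin> set w0 \<times> {..<d} \<longrightarrow> (\<lambda>(i, l). coeff (p i) l) x \<in> C"
      using p_coeff p_0 C(2) by (auto simp: not_less)
  qed
  also have "F (\<lambda>(i, l). coeff (p i) l) = (\<Sum>w\<in>W. a w * (\<Prod>j<d. poly (p (w ! j)) (t j)))"
    by (simp add: F_def sum_coeff)
  also have "\<dots> = (\<Sum>w\<in>W. if w = w0 then a w else 0)"
  proof (rule sum.cong)
    fix w assume "w \<in> W"
    then have l: "length w = length w0" "length w0 = d"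
      using len w0 by auto
    \<comment> \<open>A word other than \<open>w0\<close> differs from it at some position, where
      its factor is 0.\<close>
    have "(\<Prod>j<d. poly (p (w ! j)) (t j)) = (if w = w0 then 1 else 0)"
    proof (cases "w = w0")
      case False
      then obtain j where "j < d" "w0 ! j \<noteq> w ! j"
        using l by (metis nth_equalityI)
      then have "\<exists>j\<in>{..<d}. poly (p (w ! j)) (t j) = 0"
        by (auto simp: p_eval)
      then show ?thesis
        using False by (simp add: prod_zero_iff)
    qed (simp add: p_eval)
    then show "a w * (\<Prod>j<d. poly (p (w ! j)) (t j)) = (if w = w0 then a w else 0)"
      by simp
  qed simp
  also have "\<dots> = a w0"
    using \<open>finite W\<close> w0 by simp
  finally show ?thesis .
qed


section \<open>Invariants with infinite orbit\<close>

lemma funpow_fixed_mult: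
  assumes "(f ^^ r) x = x"
  shows "(f ^^ (r * t)) x = x"
proof (induction t)
  case (Suc t)
  then show ?case
    using assms by (simp add: funpow_add)
qed simp

text \<open>Cancelling the injective \<open>r\<close>-th power in a coincidence at
  \<open>r < r'\<close> would leave \<open>x\<close> fixed by the power
  \<open>r' - r\<close>.\<close>

lemma inj_funpow_orbit:
  assumes "inj f" "\<And>r. 0 < r \<Longrightarrow> (f ^^ r) x \<noteq> x"
  shows "inj (\<lambda>r. (f ^^ r) x)"
proof (rule linorder_injI)
  fix r r' :: nat assume "r < r'"
  then have "(f ^^ r') x = (f ^^ r) ((f ^^ (r' - r)) x)"
    by (simp flip: funpow_add comp_apply[of "f ^^ r" "f ^^ (r' - r)"])
  moreover have "inj (f ^^ r)"
    using assms(1) by (rule inj_fn)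
  ultimately show "(f ^^ r) x \<noteq> (f ^^ r') x"
    using assms(2)[of "r' - r"] \<open>r < r'\<close> by (metis injD zero_less_diff)
qed

text \<open>If all the norms of \<open>c - x\<close> had finite orbits, some power of \<open>\<mu>\<close> would fix
  the polynomial with the roots \<open>g x\<close>, whence permute these roots.\<close>

lemma exists_invariant_with_infinite_orbit:
  fixes \<Lambda> :: "'l::field set"
  assumes "finite G" and aut: "\<And>g. g \<in> G \<Longrightarrow> field_aut g" and "id \<in> G"
    and comp: "\<And>g h. g \<in> G \<Longrightarrow> h \<in> G \<Longrightarrow> g \<circ> h \<in> G"
    and \<Lambda>: "1 \<in> \<Lambda>" "\<And>a b. a \<in> \<Lambda> \<Longrightarrow> b \<in> \<Lambda> \<Longrightarrow> a * b \<in> \<Lambda>" "\<And>a b. a \<in> \<Lambda> \<Longrightarrow> b \<in> \<Lambda> \<Longrightarrow> a - b \<in> \<Lambda>"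
      "\<And>g a. g \<in> G \<Longrightarrow> a \<in> \<Lambda> \<Longrightarrow> g a \<in> \<Lambda>"
    and C: "infinite C" "C \<subseteq> \<Lambda>" "\<And>g c. g \<in> G \<Longrightarrow> c \<in> C \<Longrightarrow> g c = c" "\<And>c. c \<in> C \<Longrightarrow> \<mu> c = c"
    and "field_aut \<mu>" and x: "x \<in> \<Lambda>" "\<And>r. 0 < r \<Longrightarrow> (\<mu> ^^ r) x \<noteq> x"
  shows "\<exists>\<gamma>\<in>fixed_points G \<Lambda>. \<forall>r>0. (\<mu> ^^ r) \<gamma> \<noteq> \<gamma>"
proof (rule ccontr)
  assume contra: "\<not> ?thesis"
  \<comment> \<open>\<open>N c\<close> is the norm of \<open>c - x\<close>, that is, the value at
    \<open>c\<close> of the polynomial with roots \<open>g x\<close>.\<close>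
  define N where "N c = (\<Prod>g\<in>G. c - g x)" for c
  have N_fixed: "N c \<in> fixed_points G \<Lambda>" if "c \<in> C" for c
  proof -
    have "prod f A \<in> \<Lambda>" if "\<And>a. a \<in> A \<Longrightarrow> f a \<in> \<Lambda>" for f and A :: "('l \<Rightarrow> 'l) set"
      using that \<Lambda>(1,2) by (induction A rule: infinite_finite_induct) auto
    then have "N c \<in> \<Lambda>"
      unfolding N_def using \<Lambda>(3,4) x that C(2) by auto
    moreover have "g (N c) = N c" if "g \<in> G" for g
    proof -
      interpret field_aut g
        using aut that .
      have inj_on: "inj_on ((\<circ>) g) G"
        by (auto intro!: inj_onI simp: fun_eq_iff)
      moreover have "(\<circ>) g ` G \<subseteq> G"
        using comp that by auto
      ultimately have "(\<circ>) g ` G = G"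
        using \<open>finite G\<close> by (simp add: endo_inj_surj)
      then have "N c = (\<Prod>h\<in>(\<circ>) g ` G. c - h x)"
        by (simp add: N_def)
      also have "\<dots> = (\<Prod>h\<in>G. c - g (h x))"
        by (simp add: prod.reindex inj_on)
      also have "\<dots> = g (N c)"
        using C(3)[OF that \<open>c \<in> C\<close>] by (simp add: N_def prod diff)
      finally show ?thesis ..
    qed
    ultimately show ?thesis
      by (simp add: fixed_points_def)
  qed
  \<comment> \<open>One point more than the degree of that polynomial, so that its values on
    \<open>A\<close> determine it.\<close>
  obtain A where A: "A \<subseteq> C" "finite A" "card A = Suc (card G)"
    using C(1) infinite_arbitrarily_large by metis
  have "\<exists>r>0. (\<mu> ^^ r) (N c) = N c" if "c \<in> A" for c
    using contra N_fixed that A(1) by blast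
  then obtain r where r: "\<And>c. c \<in> A \<Longrightarrow> 0 < r c" "\<And>c. c \<in> A \<Longrightarrow> (\<mu> ^^ r c) (N c) = N c"
    by metis
  \<comment> \<open>A common period of the finitely many norms.\<close>
  define R where "R = prod r A"
  have "0 < R"
    unfolding R_def using r(1) by (intro prod_pos) auto
  have R_fixed: "(\<mu> ^^ (R * t)) (N c) = N c" if "c \<in> A" for c t
  proof -
    have "R = r c * prod r (A - {c})"
      unfolding R_def using A(2) that by (simp add: prod.remove)
    then show ?thesis
      using funpow_fixed_mult[OF r(2)[OF that]] by (simp add: mult.assoc)
  qed
  \<comment> \<open>The roots \<open>g x\<close> are moved by the power \<open>R * t\<close> of
    \<open>\<mu>\<close>. Since this power fixes the points of \<open>A\<close> and the norms there,
    \<open>P t\<close> takes the same values on \<open>A\<close> for every \<open>t\<close>.\<close>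
  define P where "P t = (\<Prod>g\<in>G. [:- (\<mu> ^^ (R * t)) (g x), 1:])" for t
  have deg: "degree (P t) < card A" for t
  proof -
    have "degree (P t) \<le> sum (degree \<circ> (\<lambda>g. [:- (\<mu> ^^ (R * t)) (g x), 1:])) G"
      unfolding P_def using \<open>finite G\<close> by (rule degree_prod_sum_le)
    then show ?thesis
      using A(3) by simp
  qed
  have eval: "poly (P t) c = N c" if "c \<in> A" for t c
  proof -
    interpret field_aut "\<mu> ^^ (R * t)"
      using \<open>field_aut \<mu>\<close> by (rule field_aut_funpow)
    have "(\<mu> ^^ (R * t)) c = c"
      using that A(1) C(4) funpow_fixed_mult[where f = \<mu> and r = 1 and x = c and t = "R * t"] by auto
    then have "N c = (\<Prod>g\<in>G. c - (\<mu> ^^ (R * t)) (g x))"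
      using R_fixed[OF that, of t] by (simp add: N_def prod diff)
    then show ?thesis
      by (simp add: P_def poly_prod)
  qed
  have P_eq: "P t = P 0" for t
    by (rule poly_eqI_degree[of A]) (simp_all add: eval deg)
  \<comment> \<open>With \<open>g = id\<close>, the image of \<open>x\<close> is a root of
    \<open>P t\<close>, which equals \<open>P 0\<close>. Thus infinitely many points of the orbit
    are roots of one nonzero polynomial.\<close>
  have "poly (P 0) ((\<mu> ^^ (R * t)) x) = 0" for t
  proof -
    have "\<exists>g\<in>G. poly [:- (\<mu> ^^ (R * t)) (g x), 1:] ((\<mu> ^^ (R * t)) x) = 0"
      using \<open>id \<in> G\<close> by (intro bexI[of _ id]) auto
    then have "poly (P t) ((\<mu> ^^ (R * t)) x) = 0"
      using \<open>finite G\<close> by (simp add: P_def poly_prod)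
    then show ?thesis
      by (simp only: P_eq[of t])
  qed
  then have "range (\<lambda>t. (\<mu> ^^ (R * t)) x) \<subseteq> {y. poly (P 0) y = 0}"
    by auto
  moreover have "P 0 \<noteq> 0"
    using \<open>finite G\<close> by (simp add: P_def)
  ultimately have "finite (range (\<lambda>t. (\<mu> ^^ (R * t)) x))"
    using poly_roots_finite finite_subset by metis
  moreover have "inj (\<lambda>t. (\<mu> ^^ (R * t)) x)"
  proof -
    have "inj (\<lambda>r. (\<mu> ^^ r) x)"
      using \<open>field_aut \<mu>\<close> x(2) by (intro inj_funpow_orbit field_aut.inj) auto
    then show ?thesis
      using \<open>0 < R\<close> by (auto intro!: injI dest: injD)
  qed
  ultimately show False
    using finite_imageD by blast
qed


section \<open>Leading coefficients in skew monoid rings\<close>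

lemma lookup_skew_mult:
  "Poly_Mapping.lookup (skew_mult f g) \<kappa> =
    (\<Sum>\<mu>\<in>Poly_Mapping.keys f. \<Sum>\<nu>\<in>Poly_Mapping.keys g.
      if \<mu> \<circ> \<nu> = \<kappa> then Poly_Mapping.lookup f \<mu> * \<mu> (Poly_Mapping.lookup g \<nu>) else 0)"
  by (simp add: skew_mult_def lookup_sum lookup_single when_def)

lemma keys_skew_mult:
  assumes "\<kappa> \<in> Poly_Mapping.keys (skew_mult f g)"
  obtains \<mu> \<nu> where "\<mu> \<in> Poly_Mapping.keys f" "\<nu> \<in> Poly_Mapping.keys g" "\<kappa> = \<mu> \<circ> \<nu>"
proof -
  have "\<exists>\<mu>\<in>Poly_Mapping.keys f. \<exists>\<nu>\<in>Poly_Mapping.keys g. \<mu> \<circ> \<nu> = \<kappa>"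
  proof (rule ccontr)
    assume "\<not> ?thesis"
    then have "Poly_Mapping.lookup (skew_mult f g) \<kappa> = 0"
      unfolding lookup_skew_mult by (intro sum.neutral ballI) auto
    with assms show False
      by (simp add: in_keys_iff)
  qed
  with that show thesis
    by blast
qed

lemma lookup_skew_mult_scalar:
  "Poly_Mapping.lookup (skew_mult (skew_scalar a) f) \<nu> = a * Poly_Mapping.lookup f \<nu>"
\<comment> \<open>For \<open>a = 0\<close> the support of \<open>skew_scalar a\<close> is empty
  instead of \<open>{id}\<close>.\<close>
proof (cases "a = 0")
  case True
  then show ?thesis
    by (simp add: lookup_skew_mult skew_scalar_def)
next
  case False
  then have "Poly_Mapping.lookup (skew_mult (skew_scalar a) f) \<nu> =
      (\<Sum>\<nu>'\<in>Poly_Mapping.keys f. if \<nu>' = \<nu> then a * Poly_Mapping.lookup f \<nu>' else 0)"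
    by (simp add: lookup_skew_mult skew_scalar_def)
  then show ?thesis
    by (simp add: in_keys_iff)
qed

lemma keys_skew_mult_scalar:
  "Poly_Mapping.keys (skew_mult (skew_scalar a) f) \<subseteq> Poly_Mapping.keys f"
  by (auto simp: in_keys_iff lookup_skew_mult_scalar)

lemma funpow_weight:
  fixes \<phi> :: "('a \<Rightarrow> 'a) \<Rightarrow> int"
  assumes M: "id \<in> M" "\<And>\<alpha> \<beta>. \<alpha> \<in> M \<Longrightarrow> \<beta> \<in> M \<Longrightarrow> \<alpha> \<circ> \<beta> \<in> M"
    and \<phi>: "\<And>\<alpha> \<beta>. \<alpha> \<in> M \<Longrightarrow> \<beta> \<in> M \<Longrightarrow> \<phi> (\<alpha> \<circ> \<beta>) = \<phi> \<alpha> + \<phi> \<beta>"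
    and \<mu>: "\<mu> \<in> M"
  shows "\<mu> ^^ n \<in> M" "\<phi> (\<mu> ^^ n) = int n * \<phi> \<mu>"
proof -
  have "\<phi> id = 0"
    using \<phi>[OF M(1) M(1)] by simp
  have "\<mu> ^^ n \<in> M \<and> \<phi> (\<mu> ^^ n) = int n * \<phi> \<mu>"
  proof (induction n)
    case 0
    show ?case
      by (simp only: funpow.simps M(1) \<open>\<phi> id = 0\<close>) simp
  next
    case (Suc n)
    have "int (Suc n) * \<phi> \<mu> = \<phi> \<mu> + int n * \<phi> \<mu>"
      by (simp add: algebra_simps)
    with Suc show ?case
      using M(2)[OF \<mu>, of "\<mu> ^^ n"] \<phi>[OF \<mu>, of "\<mu> ^^ n"] by (simp only: funpow.simps)
  qed
  then show "\<mu> ^^ n \<in> M" "\<phi> (\<mu> ^^ n) = int n * \<phi> \<mu>"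
    by auto
qed

text \<open>The support of \<open>u\<close> has the unique maximum \<open>\<mu>\<close> for the weight \<open>\<phi>\<close>, so a product of
  multiples \<open>\<gamma> i \<cdot> u\<close> has its leading term at the corresponding power of \<open>\<mu>\<close>.\<close>

lemma leading_term_word:
  fixes \<phi> :: "('l::field \<Rightarrow> 'l) \<Rightarrow> int"
  assumes M: "id \<in> M" "\<And>\<alpha> \<beta>. \<alpha> \<in> M \<Longrightarrow> \<beta> \<in> M \<Longrightarrow> \<alpha> \<circ> \<beta> \<in> M"
    and \<phi>: "\<And>\<alpha> \<beta>. \<alpha> \<in> M \<Longrightarrow> \<beta> \<in> M \<Longrightarrow> \<phi> (\<alpha> \<circ> \<beta>) = \<phi> \<alpha> + \<phi> \<beta>"
    and u: "Poly_Mapping.keys u \<subseteq> M" and \<mu>: "\<mu> \<in> M" "field_aut \<mu>"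
    and max: "\<And>\<nu>. \<nu> \<in> Poly_Mapping.keys u \<Longrightarrow> \<phi> \<nu> \<le> \<phi> \<mu>"
      "\<And>\<nu>. \<nu> \<in> Poly_Mapping.keys u \<Longrightarrow> \<phi> \<nu> = \<phi> \<mu> \<Longrightarrow> \<nu> = \<mu>"
    and P_def: "\<And>w. P w =
      foldr (\<lambda>i b. skew_mult (skew_mult (skew_scalar (\<gamma> i)) u) b) w (Poly_Mapping.single id 1)"
  shows "Poly_Mapping.keys (P w) \<subseteq> M"
    and "\<nu> \<in> Poly_Mapping.keys (P w) \<Longrightarrow> \<phi> \<nu> \<le> int (length w) * \<phi> \<mu>"
    and "\<nu> \<in> Poly_Mapping.keys (P w) \<Longrightarrow> \<phi> \<nu> = int (length w) * \<phi> \<mu> \<Longrightarrow> \<nu> = \<mu> ^^ length w"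
    and "Poly_Mapping.lookup (P w) (\<mu> ^^ length w) =
      (\<Prod>j<length w. (\<mu> ^^ j) (\<gamma> (w ! j) * Poly_Mapping.lookup u \<mu>))"
proof (induction w arbitrary: \<nu>)
  case Nil
  {
    case 1
    show ?case
      using M(1) by (simp add: P_def)
  next
    case 2
    then have "\<nu> = id"
      by (simp add: P_def)
    have "\<phi> id = 0"
      using \<phi>[OF M(1) M(1)] by simp
    then have "\<phi> \<nu> = 0"
      by (simp only: \<open>\<nu> = id\<close>)
    then show ?case
      by simp
  next
    case 3
    then show ?case
      by (simp add: P_def id_def)
  next
    case 4
    show ?case
      by (simp add: P_def id_def)
  }
next
  case (Cons i w)
  note IH = Cons.IH
  interpret field_aut \<mu> by fact
  let ?a = "skew_mult (skew_scalar (\<gamma> i)) u"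
  have P: "P (i # w) = skew_mult ?a (P w)"
    by (simp add: P_def)
  have a: "\<alpha> \<in> Poly_Mapping.keys u" if "\<alpha> \<in> Poly_Mapping.keys ?a" for \<alpha>
    using keys_skew_mult_scalar that by blast
  \<comment> \<open>Weights add, so the maximal total is reached only if both factors have maximal
    weight, which determines them.\<close>
  have le: "\<phi> (\<alpha> \<circ> \<beta>) \<le> int (length (i # w)) * \<phi> \<mu> \<and>
      (\<phi> (\<alpha> \<circ> \<beta>) = int (length (i # w)) * \<phi> \<mu> \<longrightarrow> \<alpha> = \<mu> \<and> \<beta> = \<mu> ^^ length w)"
    if that_keys: "\<alpha> \<in> Poly_Mapping.keys ?a" "\<beta> \<in> Poly_Mapping.keys (P w)" for \<alpha> \<beta>
  proof -
    have "\<alpha> \<in> M" "\<beta> \<in> M"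
      using a that_keys u IH(1) by auto
    then have "\<phi> (\<alpha> \<circ> \<beta>) = \<phi> \<alpha> + \<phi> \<beta>"
      by (rule \<phi>)
    moreover have "\<phi> \<alpha> \<le> \<phi> \<mu>" "\<phi> \<beta> \<le> int (length w) * \<phi> \<mu>"
      using max(1) a that_keys IH(2) by auto
    moreover have "\<alpha> = \<mu>" if "\<phi> \<alpha> = \<phi> \<mu>"
      using max(2)[OF a that] that_keys(1) by auto
    moreover have "\<beta> = \<mu> ^^ length w" if "\<phi> \<beta> = int (length w) * \<phi> \<mu>"
      using IH(3)[OF that_keys(2) that] .
    ultimately show ?thesis
      by (auto simp: algebra_simps)
  qed
  {
    case 1
    show ?case
    proof
      fix \<kappa> assume "\<kappa> \<in> Poly_Mapping.keys (P (i # w))"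
      then obtain \<alpha> \<beta> where "\<alpha> \<in> Poly_Mapping.keys ?a" "\<beta> \<in> Poly_Mapping.keys (P w)" "\<kappa> = \<alpha> \<circ> \<beta>"
        unfolding P by (rule keys_skew_mult)
      then show "\<kappa> \<in> M"
        using M(2)[of \<alpha> \<beta>] a[of \<alpha>] u IH(1) by auto
    qed
  next
    case 2
    then obtain \<alpha> \<beta> where "\<alpha> \<in> Poly_Mapping.keys ?a" "\<beta> \<in> Poly_Mapping.keys (P w)" "\<nu> = \<alpha> \<circ> \<beta>"
      unfolding P by (rule keys_skew_mult)
    then show ?case
      using le[of \<alpha> \<beta>] by (simp only:)
  next
    case 3
    from 3(1) obtain \<alpha> \<beta> where "\<alpha> \<in> Poly_Mapping.keys ?a" "\<beta> \<in> Poly_Mapping.keys (P w)" "\<nu> = \<alpha> \<circ> \<beta>"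
      unfolding P by (rule keys_skew_mult)
    then have "\<alpha> = \<mu> \<and> \<beta> = \<mu> ^^ length w"
      using le[of \<alpha> \<beta>] 3(2) by (simp only:)
    with \<open>\<nu> = \<alpha> \<circ> \<beta>\<close> show ?case
      by (simp only: list.size funpow.simps add_Suc_right add_0_right)
  next
    case 4
    note pow = funpow_weight[of M \<phi> \<mu>, OF M \<phi> \<mu>(1)]
    \<comment> \<open>Only one pair contributes at the top power of \<open>\<mu>\<close>, so nothing
      can cancel there.\<close>
    have iff: "\<alpha> \<circ> \<beta> = \<mu> ^^ length (i # w) \<longleftrightarrow> \<alpha> = \<mu> \<and> \<beta> = \<mu> ^^ length w"
      if "\<alpha> \<in> Poly_Mapping.keys ?a" "\<beta> \<in> Poly_Mapping.keys (P w)" for \<alpha> \<beta>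
    proof
      assume "\<alpha> \<circ> \<beta> = \<mu> ^^ length (i # w)"
      then have "\<phi> (\<alpha> \<circ> \<beta>) = int (length (i # w)) * \<phi> \<mu>"
        using pow(2)[of "length (i # w)"] by (simp only:)
      then show "\<alpha> = \<mu> \<and> \<beta> = \<mu> ^^ length w"
        using le[OF that] by blast
    qed (simp only: list.size funpow.simps add_Suc_right add_0_right)
    have "Poly_Mapping.lookup (P (i # w)) (\<mu> ^^ length (i # w)) =
      (\<Sum>\<alpha>\<in>Poly_Mapping.keys ?a. \<Sum>\<beta>\<in>Poly_Mapping.keys (P w).
        if \<alpha> = \<mu> then if \<beta> = \<mu> ^^ length w
          then Poly_Mapping.lookup ?a \<alpha> * \<alpha> (Poly_Mapping.lookup (P w) \<beta>) else 0 else 0)"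
      unfolding P lookup_skew_mult by (intro sum.cong refl, subst iff) auto
    also have "\<dots> = (\<Sum>\<alpha>\<in>Poly_Mapping.keys ?a. if \<alpha> = \<mu> then
        Poly_Mapping.lookup ?a \<alpha> * \<alpha> (Poly_Mapping.lookup (P w) (\<mu> ^^ length w)) else 0)"
      by (intro sum.cong refl) (auto simp: in_keys_iff)
    also have "\<dots> = Poly_Mapping.lookup ?a \<mu> * \<mu> (Poly_Mapping.lookup (P w) (\<mu> ^^ length w))"
      by (auto simp: in_keys_iff)
    \<comment> \<open>Applying \<open>\<mu>\<close> to the product for \<open>w\<close> raises every
      power by one; the new letter \<open>i\<close> supplies the factor for
      \<open>j = 0\<close>.\<close>
    also have "\<dots> = (\<Prod>j<length (i # w). (\<mu> ^^ j) (\<gamma> ((i # w) ! j) * Poly_Mapping.lookup u \<mu>))"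
      by (simp add: IH(4) lookup_skew_mult_scalar prod prod.lessThan_Suc_shift del: prod.lessThan_Suc)
    finally show ?case .
  }
qed


section \<open>Polynomial identities in subrings of the fixed ring\<close>

lemma skew_fixed_ring_simps [simp]:
  "monoid.mult (skew_fixed_ring M G) = skew_mult"
  "one (skew_fixed_ring M G) = Poly_Mapping.single id 1"
  "ring.zero (skew_fixed_ring M G) = 0"
  "add (skew_fixed_ring M G) = (+)"
  by (simp_all add: skew_fixed_ring_def skew_monoid_ring_def)

lemma carrier_skew_fixed_ring:
  "carrier (skew_fixed_ring M G) = {f. Poly_Mapping.keys f \<subseteq> M \<and> (\<forall>g\<in>G. skew_act g f = f)}"
  by (simp add: skew_fixed_ring_def skew_monoid_ring_def)

text \<open>The additive laws come from the type, so closure of the carrier suffices to replace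
  \<open>finsum\<close> by an ordinary sum.\<close>

lemma finsum_eq_sum:
  fixes R :: "('a::comm_monoid_add, 'b) ring_scheme"
  assumes R: "add R = (+)" "ring.zero R = 0" and "0 \<in> carrier R"
    and "\<And>x y. x \<in> carrier R \<Longrightarrow> y \<in> carrier R \<Longrightarrow> x + y \<in> carrier R"
    and "finite A" "f \<in> A \<rightarrow> carrier R"
  shows "finsum R f A = sum f A"
proof -
  interpret abelian_monoid R
    by (rule abelian_monoidI) (use assms in \<open>auto simp: ac_simps\<close>)
  show ?thesis
    using assms(5,6) by (induction A rule: finite_induct) (auto simp: R)
qed

lemma free_eval_skew:
  assumes "subring U (skew_fixed_ring M G)" "\<And>c. \<iota> c \<in> U" "\<And>i. a i \<in> U"
  shows "free_eval \<iota> ((skew_fixed_ring M G)\<lparr>carrier := U\<rparr>) a f =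
    (\<Sum>w\<in>Poly_Mapping.keys f. skew_mult (\<iota> (Poly_Mapping.lookup f w))
      (foldr (\<lambda>i b. skew_mult (a i) b) w (Poly_Mapping.single id 1)))"
proof -
  interpret subring U "skew_fixed_ring M G" by fact
  have "foldr (\<lambda>i b. skew_mult (a i) b) w (Poly_Mapping.single id 1) \<in> U" for w
    using assms(3) m_closed one_closed by (induction w) auto
  then show ?thesis
    unfolding free_eval_def
    by (subst finsum_eq_sum)
      (use assms(2) subgroup.m_closed[OF subgroup_axioms] subgroup.one_closed[OF subgroup_axioms] m_closed
       in auto)
qed

text \<open>Since \<open>\<phi> \<mu>\<close> is positive, words shorter than the degree cannot
  reach the top power of \<open>\<mu>\<close>. The longest words share a nonzero factor there, and
  dividing by it gives the relation required by \<open>word_coefficients_vanish\<close>.\<close>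

lemma leading_weight_not_PI:
  fixes \<iota> :: "'k::field \<Rightarrow> 'l::field" and \<phi> :: "('l \<Rightarrow> 'l) \<Rightarrow> int"
  assumes M: "id \<in> M" "\<And>\<alpha> \<beta>. \<alpha> \<in> M \<Longrightarrow> \<beta> \<in> M \<Longrightarrow> \<alpha> \<circ> \<beta> \<in> M"
    and \<phi>: "\<And>\<alpha> \<beta>. \<alpha> \<in> M \<Longrightarrow> \<beta> \<in> M \<Longrightarrow> \<phi> (\<alpha> \<circ> \<beta>) = \<phi> \<alpha> + \<phi> \<beta>"
    and U: "subring U (skew_fixed_ring M G)" "skew_scalar ` \<Gamma> \<subseteq> U"
    and \<Gamma>: "\<And>a b. a \<in> \<Gamma> \<Longrightarrow> b \<in> \<Gamma> \<Longrightarrow> a + b \<in> \<Gamma>" "\<And>a b. a \<in> \<Gamma> \<Longrightarrow> b \<in> \<Gamma> \<Longrightarrow> a * b \<in> \<Gamma>"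
    and \<iota>: "range \<iota> \<subseteq> \<Gamma>" "infinite (range \<iota>)" "\<iota> 0 = 0" "\<iota> 1 = 1" "\<And>c. \<mu> (\<iota> c) = \<iota> c"
    and u: "u \<in> U" and \<mu>: "\<mu> \<in> Poly_Mapping.keys u" "field_aut \<mu>" "0 < \<phi> \<mu>"
    and max: "\<And>\<nu>. \<nu> \<in> Poly_Mapping.keys u \<Longrightarrow> \<phi> \<nu> \<le> \<phi> \<mu>"
      "\<And>\<nu>. \<nu> \<in> Poly_Mapping.keys u \<Longrightarrow> \<phi> \<nu> = \<phi> \<mu> \<Longrightarrow> \<nu> = \<mu>"
    and \<gamma>: "\<gamma> \<in> \<Gamma>" "\<And>r. 0 < r \<Longrightarrow> (\<mu> ^^ r) \<gamma> \<noteq> \<gamma>"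
  shows "\<not> PI_algebra (\<lambda>c. skew_scalar (\<iota> c)) ((skew_fixed_ring M G)\<lparr>carrier := U\<rparr>)"
proof
  assume "PI_algebra (\<lambda>c. skew_scalar (\<iota> c)) ((skew_fixed_ring M G)\<lparr>carrier := U\<rparr>)"
  then obtain f :: "nat list \<Rightarrow>\<^sub>0 'k" and w0
    where w0: "w0 \<in> Poly_Mapping.keys f" "Poly_Mapping.lookup f w0 = 1"
      and deg: "\<And>v. v \<in> Poly_Mapping.keys f \<Longrightarrow> length v \<le> length w0"
      and f: "\<And>a. (\<And>i. a i \<in> U) \<Longrightarrow>
        free_eval (\<lambda>c. skew_scalar (\<iota> c)) ((skew_fixed_ring M G)\<lparr>carrier := U\<rparr>) a f = 0"
    unfolding PI_algebra_def by auto
  interpret subring U "skew_fixed_ring M G" by fact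
  define d where "d = length w0"
  define W where "W = {w \<in> Poly_Mapping.keys f. length w = d}"
  define t where "t j = (\<mu> ^^ j) \<gamma>" for j
  have uM: "Poly_Mapping.keys u \<subseteq> M"
    using u subset by (auto simp: carrier_skew_fixed_ring)
  with \<mu>(1) have "\<mu> \<in> M"
    by auto
  \<comment> \<open>The empty sum is in \<open>\<Gamma>\<close> because 0 is the image of a
    scalar.\<close>
  have sum_\<Gamma>: "sum g {..<n} \<in> \<Gamma>" if "\<And>l. g l \<in> \<Gamma>" for g and n :: nat
    using that \<Gamma>(1) \<iota>(1,3) by (induction n) (auto simp: image_subset_iff dest: spec[of _ 0])
  have "\<iota> (Poly_Mapping.lookup f w0) = 0"
  proof (rule word_coefficients_vanish[of W d t "range \<iota>" "\<lambda>w. \<iota> (Poly_Mapping.lookup f w)"])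
    show "finite W" "\<And>w. w \<in> W \<Longrightarrow> length w = d" "w0 \<in> W"
      using w0 by (auto simp: W_def d_def)
    show "inj_on t {..<d}"
      unfolding t_def using inj_funpow_orbit[OF field_aut.inj[OF \<mu>(2)] \<gamma>(2)]
      by (rule inj_on_subset) auto
    show "infinite (range \<iota>)" "0 \<in> range \<iota>"
      using \<iota> by (auto intro: rev_image_eqI[of 0])
  next
    fix c :: "nat \<times> nat \<Rightarrow> 'l"
    assume c: "\<forall>x. c x \<in> range \<iota>"
    define \<gamma>' where "\<gamma>' i = (\<Sum>l<d. c (i, l) * \<gamma> ^ l)" for i
    have "1 \<in> \<Gamma>"
      using \<iota>(1) \<iota>(4) by (metis image_subset_iff iso_tuple_UNIV_I)
    then have "\<gamma> ^ l \<in> \<Gamma>" for l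
      using \<gamma>(1) \<Gamma>(2) by (induction l) auto
    then have \<gamma>': "\<gamma>' i \<in> \<Gamma>" for i
      unfolding \<gamma>'_def using c \<iota>(1) by (intro sum_\<Gamma> \<Gamma>(2)) auto
    define a where "a i = skew_mult (skew_scalar (\<gamma>' i)) u" for i
    have a: "a i \<in> U" for i
      using m_closed[of "skew_scalar (\<gamma>' i)" u] \<gamma>' U(2) u by (auto simp: a_def)
    define P where "P w = foldr (\<lambda>i b. skew_mult (a i) b) w (Poly_Mapping.single id 1)" for w
    note lead = leading_term_word[of M \<phi> u \<mu> P \<gamma>', OF M \<phi> uM \<open>\<mu> \<in> M\<close> \<mu>(2) max P_def[unfolded a_def]]
    \<comment> \<open>The contribution of the leading coefficient of \<open>u\<close>, the same for
      all words of length \<open>d\<close>.\<close>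
    define A where "A = (\<Prod>j<d. (\<mu> ^^ j) (Poly_Mapping.lookup u \<mu>))"
    have aut: "field_aut (\<mu> ^^ j)" for j
      using \<mu>(2) by (rule field_aut_funpow)
    have "A \<noteq> 0"
      using \<mu>(1) by (auto simp: A_def in_keys_iff field_aut.eq_0_iff[OF aut])
    note pow = funpow_weight[of M \<phi> \<mu>, OF M \<phi> \<open>\<mu> \<in> M\<close>]
    have top: "Poly_Mapping.lookup (P w) (\<mu> ^^ d) =
        (if w \<in> W then A * (\<Prod>j<d. \<Sum>l<d. c (w ! j, l) * t j ^ l) else 0)"
      if "w \<in> Poly_Mapping.keys f" for w
    proof (cases "length w = d")
      case True
      \<comment> \<open>\<open>\<mu>\<close> fixes the coefficients, so its powers only move the
        point at which the polynomial is evaluated, from \<open>\<gamma>\<close> to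
        \<open>t j\<close>.\<close>
      have eval: "(\<mu> ^^ j) (\<gamma>' i) = (\<Sum>l<d. c (i, l) * t j ^ l)" for i j
      proof -
        interpret j: field_aut "\<mu> ^^ j"
          by (rule aut)
        have "(\<mu> ^^ j) (c x) = c x" for x
        proof -
          obtain b where "c x = \<iota> b"
            using c by (meson rangeE)
          then show ?thesis
            using funpow_fixed_mult[where f = \<mu> and r = 1 and x = "\<iota> b" and t = j] \<iota>(5) by simp
        qed
        then show ?thesis
          by (simp add: \<gamma>'_def j.sum j.mult j.power t_def)
      qed
      have "(\<mu> ^^ j) (\<gamma>' (w ! j) * Poly_Mapping.lookup u \<mu>) =
          (\<Sum>l<d. c (w ! j, l) * t j ^ l) * (\<mu> ^^ j) (Poly_Mapping.lookup u \<mu>)" for j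
        by (simp only: field_aut.mult[OF aut] eval)
      with lead(4)[of w] have "Poly_Mapping.lookup (P w) (\<mu> ^^ d) =
          (\<Prod>j<d. (\<Sum>l<d. c (w ! j, l) * t j ^ l) * (\<mu> ^^ j) (Poly_Mapping.lookup u \<mu>))"
        by (simp only: True)
      also have "\<dots> = A * (\<Prod>j<d. \<Sum>l<d. c (w ! j, l) * t j ^ l)"
        by (simp only: prod.distrib A_def mult.commute)
      finally show ?thesis
        using that True by (simp add: W_def)
    next
      case False
      then have "length w < d"
        using deg[OF that] by (simp add: d_def)
      then have "int (length w) * \<phi> \<mu> < \<phi> (\<mu> ^^ d)"
        using pow[of d] \<mu>(3) by simp
      then have "\<mu> ^^ d \<notin> Poly_Mapping.keys (P w)"
        using lead(2)[of "\<mu> ^^ d" w] by (meson not_less)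
      then show ?thesis
        using False by (simp add: W_def in_keys_iff)
    qed
    have scal: "skew_scalar (\<iota> b) \<in> U" for b
      using U(2) \<iota>(1) by (auto simp: image_subset_iff)
    \<comment> \<open>The identity is now read off at the single automorphism
      \<open>\<mu> ^^ d\<close>.\<close>
    have "0 = Poly_Mapping.lookup (free_eval (\<lambda>c. skew_scalar (\<iota> c)) ((skew_fixed_ring M G)\<lparr>carrier := U\<rparr>) a f) (\<mu> ^^ d)"
      using f a by simp
    also have "\<dots> = (\<Sum>w\<in>Poly_Mapping.keys f. \<iota> (Poly_Mapping.lookup f w) * Poly_Mapping.lookup (P w) (\<mu> ^^ d))"
      using free_eval_skew[OF U(1), of "\<lambda>c. skew_scalar (\<iota> c)" a f] scal a
      by (simp add: lookup_sum lookup_skew_mult_scalar P_def)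
    also have "\<dots> = (\<Sum>w\<in>Poly_Mapping.keys f. if w \<in> W then
        \<iota> (Poly_Mapping.lookup f w) * (A * (\<Prod>j<d. \<Sum>l<d. c (w ! j, l) * t j ^ l)) else 0)"
      by (intro sum.cong refl) (simp add: top)
    also have "\<dots> = (\<Sum>w\<in>W. \<iota> (Poly_Mapping.lookup f w) * (A * (\<Prod>j<d. \<Sum>l<d. c (w ! j, l) * t j ^ l)))"
      by (rule sum.mono_neutral_cong_right) (auto simp: W_def)
    also have "\<dots> = A * (\<Sum>w\<in>W. \<iota> (Poly_Mapping.lookup f w) * (\<Prod>j<d. \<Sum>l<d. c (w ! j, l) * t j ^ l))"
      by (simp add: sum_distrib_left mult.left_commute)
    finally show "(\<Sum>w\<in>W. \<iota> (Poly_Mapping.lookup f w) * (\<Prod>j<d. \<Sum>l<d. c (w ! j, l) * t j ^ l)) = 0"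
      using \<open>A \<noteq> 0\<close> by simp
  qed
  then show False
    using w0 \<iota>(4) by simp
qed


section \<open>Supports in Galois rings\<close>

lemma conj_aut_comp:
  assumes "bij g" "bij h"
  shows "conj_aut g (conj_aut h \<mu>) = conj_aut (g \<circ> h) \<mu>"
  using o_inv_distrib[OF assms] by (simp add: conj_aut_def o_assoc)

lemma conj_aut_id [simp]: "conj_aut id \<mu> = \<mu>"
  by (simp add: conj_aut_def)

lemma inj_conj_aut:
  assumes "bij g"
  shows "inj (conj_aut g)"
proof (rule injI)
  fix \<mu> \<nu> assume "conj_aut g \<mu> = conj_aut g \<nu>"
  then have *: "g (\<mu> (inv_into UNIV g x)) = g (\<nu> (inv_into UNIV g x))" for x
    by (auto simp: conj_aut_def fun_eq_iff)
  have "\<mu> y = \<nu> y" for y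
    using *[of "g y"] assms by (simp add: bij_is_inj inv_f_f inj_eq)
  then show "\<mu> = \<nu>" ..
qed

text \<open>Conjugation by \<open>g\<close> permutes the orbit of \<open>\<epsilon>\<close>, and
  \<open>g\<close> fixes 1. Summing over the orbit as a set counts each conjugate once, whatever the
  stabilizer.\<close>

lemma orbit_sum_in_skew_fixed_ring:
  assumes "finite G" "\<And>g. g \<in> G \<Longrightarrow> field_aut g"
    and comp: "\<And>g h. g \<in> G \<Longrightarrow> h \<in> G \<Longrightarrow> g \<circ> h \<in> G"
    and M: "\<And>g. g \<in> G \<Longrightarrow> conj_aut g \<epsilon> \<in> M"
  shows "(\<Sum>\<nu>\<in>(\<lambda>g. conj_aut g \<epsilon>) ` G. Poly_Mapping.single \<nu> 1) \<in> carrier (skew_fixed_ring M G)"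
proof -
  let ?O = "(\<lambda>g. conj_aut g \<epsilon>) ` G"
  let ?h = "\<Sum>\<nu>\<in>?O. Poly_Mapping.single \<nu> (1::'a)"
  have h: "Poly_Mapping.lookup ?h \<nu> = (if \<nu> \<in> ?O then 1 else 0)" for \<nu>
    using assms(1) by (simp add: lookup_sum lookup_single when_def)
  then have keys: "Poly_Mapping.keys ?h = ?O"
    by (auto simp: in_keys_iff split: if_splits)
  moreover have "skew_act g ?h = ?h" if "g \<in> G" for g
  proof -
    interpret field_aut g
      using assms(2) that .
    have inj_on: "inj_on (conj_aut g) ?O"
      using inj_conj_aut[OF bij] by (rule inj_on_subset) auto
    have "conj_aut g (conj_aut h \<epsilon>) \<in> ?O" if "h \<in> G" for h
      using comp[OF \<open>g \<in> G\<close> that] conj_aut_comp[OF bij field_aut.bij[OF assms(2)[OF that]]]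
      by (metis imageI)
    then have "conj_aut g ` ?O \<subseteq> ?O"
      by auto
    from endo_inj_surj[OF _ this inj_on] have O: "conj_aut g ` ?O = ?O"
      using assms(1) by blast
    have "skew_act g ?h = (\<Sum>\<mu>\<in>?O. Poly_Mapping.single (conj_aut g \<mu>) 1)"
      unfolding skew_act_def keys by (rule sum.cong) (auto simp: h)
    also have "\<dots> = (\<Sum>\<nu>\<in>conj_aut g ` ?O. Poly_Mapping.single \<nu> 1)"
      using inj_on by (simp only: sum.reindex comp_def)
    finally show ?thesis
      by (simp only: O)
  qed
  ultimately show ?thesis
    using M by (auto simp: carrier_skew_fixed_ring)
qed

lemma skew_act_uminus:
  assumes "field_aut g"
  shows "skew_act g (- f) = - skew_act g f"
proof -
  interpret field_aut g by fact
  show ?thesis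
    by (simp add: skew_act_def minus single_uminus sum_negf)
qed

text \<open>Left multiplication by scalars, sums and negatives create no new support. If
  \<open>\<epsilon>\<close> were missing from all supports in \<open>U\<close>, it would be missing
  from those in \<open>KU\<close>, which is the whole fixed ring and contains the orbit sum of
  \<open>\<epsilon>\<close>.\<close>

lemma galois_ring_support:
  fixes \<Lambda> :: "'l::field set"
  assumes U: "galois_ring \<Lambda> G M U"
    and G: "finite G" "id \<in> G" "\<And>g. g \<in> G \<Longrightarrow> field_aut g"
      "\<And>g h. g \<in> G \<Longrightarrow> h \<in> G \<Longrightarrow> g \<circ> h \<in> G"
    and M: "\<And>g. g \<in> G \<Longrightarrow> conj_aut g \<epsilon> \<in> M"
  shows "\<exists>u\<in>U. \<epsilon> \<in> Poly_Mapping.keys u"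
proof (rule ccontr)
  assume contra: "\<not> ?thesis"
  define KK where "KK = skew_fixed_ring M G"
  define B where "B = skew_scalar ` fractions (fixed_points G \<Lambda>) <#>\<^bsub>KK\<^esub> U"
  have span: "generate (add_monoid KK) B = carrier KK"
    using U by (simp add: galois_ring_def Let_def product_span_def KK_def B_def)
  have B: "Poly_Mapping.lookup b \<epsilon> = 0" if "b \<in> B" for b
    using that contra
    by (auto simp: B_def KK_def set_mult_def lookup_skew_mult_scalar in_keys_iff)
  have gen: "Poly_Mapping.lookup y \<epsilon> = 0" if "y \<in> generate (add_monoid KK) B" for y
    using that
  proof induction
    case (inv y)
    then have "y \<in> generate (add_monoid KK) B"
      by (rule generate.incl)
    then have "y \<in> carrier KK"
      by (simp only: span)
    \<comment> \<open>The additive inverse is a definite description over the carrier, so membership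
      of \<open>- y\<close> has to come first.\<close>
    then have "- y \<in> carrier KK"
      using G(3) by (simp add: KK_def carrier_skew_fixed_ring skew_act_uminus)
    then have "inv\<^bsub>add_monoid KK\<^esub> y = - y"
      unfolding m_inv_def
    proof (intro the_equality)
      fix x assume "x \<in> carrier (add_monoid KK) \<and> y \<otimes>\<^bsub>add_monoid KK\<^esub> x = \<one>\<^bsub>add_monoid KK\<^esub> \<and>
        x \<otimes>\<^bsub>add_monoid KK\<^esub> y = \<one>\<^bsub>add_monoid KK\<^esub>"
      then have "y + x = 0"
        by (simp add: KK_def)
      then show "x = - y"
        by (rule minus_unique[symmetric])
    qed (simp add: KK_def)
    then show ?case
      using B[OF inv] by simp
  qed (auto simp: B KK_def lookup_add)
  let ?h = "\<Sum>\<nu>\<in>(\<lambda>g. conj_aut g \<epsilon>) ` G. Poly_Mapping.single \<nu> (1::'l)"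
  have "?h \<in> carrier KK"
    unfolding KK_def using assms by (intro orbit_sum_in_skew_fixed_ring)
  then have "?h \<in> generate (add_monoid KK) B"
    by (simp only: span)
  then have "Poly_Mapping.lookup ?h \<epsilon> = 0"
    by (rule gen)
  moreover have "Poly_Mapping.lookup ?h \<epsilon> = 1"
  proof -
    have "\<epsilon> \<in> (\<lambda>g. conj_aut g \<epsilon>) ` G"
      using G(2) by (rule rev_image_eqI) simp
    then show ?thesis
      using G(1) by (simp add: lookup_sum lookup_single when_def)
  qed
  ultimately show False
    by simp
qed


section \<open>Groups of translations and dilations\<close>

text \<open>Common treatment of both actions: \<open>T k\<close> is the effect of the \<open>k\<close>-th power of a
  basis vector on its own variable, \<open>x \<mapsto> x - k\<close> respectively \<open>x \<mapsto> q\<^sup>k x\<close>.\<close>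

locale basis_action =
  fixes T :: "int \<Rightarrow> ('n::{finite, linorder}, 'k::field_char_0) ratfun \<Rightarrow> ('n, 'k) ratfun"
    and M :: "(('n, 'k) ratfun \<Rightarrow> ('n, 'k) ratfun) set" and m :: nat
  assumes T_hom: "\<lbrakk>field_aut \<sigma>; \<And>c. \<sigma> (rf_const c) = rf_const c\<rbrakk> \<Longrightarrow> \<sigma> (T k x) = T k (\<sigma> x)"
    and T_add: "T (k + l) x = T k (T l x)"
    and T_0 [simp]: "T 0 x = x"
    and T_free: "T k (rf_var j) = rf_var j \<Longrightarrow> k = 0"
    and T_exists: "\<exists>\<epsilon>\<in>carrier (alg_Aut rf_const UNIV).
        \<forall>j. \<epsilon> (rf_var j) = (if j = i then T 1 (rf_var j) else rf_var j)"
    and M_eq: "M = generate (alg_Aut rf_const UNIV)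
      {\<epsilon> \<in> carrier (alg_Aut rf_const UNIV).
         \<exists>i. var_pos i \<le> m \<and> (\<forall>j. \<epsilon> (rf_var j) = (if j = i then T 1 (rf_var j) else rf_var j))}"
    and m: "1 \<le> m"
begin

text \<open>\<open>T (- l)\<close> undoes \<open>T l\<close>, which reduces the claim to
  \<open>T_free\<close>. This makes exponents well defined.\<close>

lemma T_eq_iff [simp]: "T k (rf_var j) = T l (rf_var j) \<longleftrightarrow> k = l"
proof
  assume "T k (rf_var j) = T l (rf_var j)"
  then have "T (- l + k) (rf_var j) = rf_var j"
    by (simp only: T_add) (simp flip: T_add)
  then show "k = l"
    using T_free by fastforce
qed simp

text \<open>The three claims are proved together: exponents add under composition only because
  automorphisms fixing the constants commute with every \<open>T k\<close>.\<close>

lemma exists_exponents: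
  assumes "\<nu> \<in> M"
  shows "field_aut \<nu> \<and> (\<forall>c. \<nu> (rf_const c) = rf_const c) \<and> (\<exists>s. \<forall>j. \<nu> (rf_var j) = T (s j) (rf_var j))"
  using assms unfolding M_eq
proof induction
  case one
  then show ?case
    using field_aut_id by (auto simp: id_def intro!: exI[of _ "\<lambda>_. 0"])
next
  case (incl \<epsilon>)
  then obtain i where "\<And>j. \<epsilon> (rf_var j) = (if j = i then T 1 (rf_var j) else rf_var j)"
    by auto
  then have "\<forall>j. \<epsilon> (rf_var j) = T (if j = i then 1 else 0) (rf_var j)"
    by simp
  then have "\<exists>s. \<forall>j. \<epsilon> (rf_var j) = T (s j) (rf_var j)"
    by (rule exI[of _ "\<lambda>j. if j = i then 1 else 0"])
  with incl show ?case
    by (simp add: carrier_alg_Aut)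
next
  case (inv \<epsilon>)
  note hyp = this
  then have car: "\<epsilon> \<in> carrier (alg_Aut rf_const UNIV)"
    by auto
  then interpret field_aut \<epsilon>
    by (simp add: carrier_alg_Aut)
  have const: "\<epsilon> (rf_const c) = rf_const c" for c
    using car by (simp add: carrier_alg_Aut)
  from hyp obtain i where i: "\<And>j. \<epsilon> (rf_var j) = (if j = i then T 1 (rf_var j) else rf_var j)"
    by auto
  \<comment> \<open>\<open>\<epsilon>\<close> carries \<open>T (- 1) (rf_var i)\<close> to
    \<open>T (- 1) (T 1 (rf_var i))\<close>, which is the variable itself.\<close>
  have "inv_into UNIV \<epsilon> (rf_var j) = T (if j = i then -1 else 0) (rf_var j)" for j
    by (rule inv_f_eq[OF inj])
      (simp add: T_hom[OF field_aut_axioms const] i flip: T_add)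
  then have "\<exists>s. \<forall>j. inv_into UNIV \<epsilon> (rf_var j) = T (s j) (rf_var j)"
    by (intro exI[of _ "\<lambda>j. if j = i then -1 else 0"]) simp
  moreover have "inv_into UNIV \<epsilon> (rf_const c) = rf_const c" for c
    by (rule inv_f_eq[OF inj const])
  ultimately show ?case
    by (simp add: m_inv_alg_Aut_UNIV[OF car] field_aut.inv[OF field_aut_axioms])
next
  case (eng \<alpha> \<beta>)
  then obtain s s' where s: "\<And>j. \<alpha> (rf_var j) = T (s j) (rf_var j)" "\<And>j. \<beta> (rf_var j) = T (s' j) (rf_var j)"
    by blast
  have "(\<alpha> \<circ> \<beta>) (rf_var j) = T (s' j + s j) (rf_var j)" for j
    using eng by (simp add: s T_add T_hom[of \<alpha>])
  then have "\<exists>s. \<forall>j. (\<alpha> \<circ> \<beta>) (rf_var j) = T (s j) (rf_var j)"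
    by (intro exI[of _ "\<lambda>j. s' j + s j"]) simp
  moreover have "field_aut (\<alpha> \<circ> \<beta>)"
    using eng by (intro field_aut_comp) auto
  moreover have "(\<alpha> \<circ> \<beta>) (rf_const c) = rf_const c" for c
    using eng by simp
  ultimately show ?case
    unfolding alg_Aut_simps by blast
qed

lemma M_aut: "\<nu> \<in> M \<Longrightarrow> field_aut \<nu>"
  and M_const: "\<nu> \<in> M \<Longrightarrow> \<nu> (rf_const c) = rf_const c"
  using exists_exponents by blast+

lemma id_in_M: "id \<in> M"
  unfolding M_eq alg_Aut_simps(2)[of rf_const UNIV, symmetric] by (rule generate.one)

lemma comp_in_M: "\<alpha> \<in> M \<Longrightarrow> \<beta> \<in> M \<Longrightarrow> \<alpha> \<circ> \<beta> \<in> M"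
  unfolding M_eq alg_Aut_simps(1)[of rf_const UNIV, symmetric] by (rule generate.eng)

definition exponent :: "(('n, 'k) ratfun \<Rightarrow> ('n, 'k) ratfun) \<Rightarrow> 'n \<Rightarrow> int" where
  "exponent \<nu> j = (THE k. \<nu> (rf_var j) = T k (rf_var j))"

lemma exponentI: "\<nu> (rf_var j) = T k (rf_var j) \<Longrightarrow> exponent \<nu> j = k"
  by (simp add: exponent_def)

lemma exponent: "\<nu> \<in> M \<Longrightarrow> \<nu> (rf_var j) = T (exponent \<nu> j) (rf_var j)"
  using exists_exponents exponentI by metis

lemma exponent_comp:
  assumes "\<alpha> \<in> M" "\<beta> \<in> M"
  shows "exponent (\<alpha> \<circ> \<beta>) j = exponent \<alpha> j + exponent \<beta> j"
  using assms
  by (intro exponentI)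
    (simp add: exponent[of \<beta>] exponent[of \<alpha>] T_hom[OF M_aut M_const] add.commute[of "exponent \<alpha> j"] T_add)

text \<open>Faithfulness of the action: it turns uniqueness of the maximal exponent vector into
  uniqueness of the leading automorphism.\<close>

lemma exponent_inject:
  assumes "\<alpha> \<in> M" "\<beta> \<in> M" "exponent \<alpha> = exponent \<beta>"
  shows "\<alpha> = \<beta>"
  using assms by (intro ratfun_aut_eqI) (simp_all add: M_aut M_const exponent)

lemma funpow_exponent:
  assumes "\<mu> \<in> M"
  shows "(\<mu> ^^ r) (rf_var j) = T (int r * exponent \<mu> j) (rf_var j)"
proof (induction r)
  case (Suc r)
  have "(\<mu> ^^ Suc r) (rf_var j) = T (int r * exponent \<mu> j) (T (exponent \<mu> j) (rf_var j))"
    using assms Suc by (simp add: T_hom[OF M_aut M_const] exponent)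
  then show ?case
    by (simp add: algebra_simps flip: T_add)
qed simp

lemma exists_nontrivial_exponent: "\<exists>\<epsilon>\<in>M. \<exists>i. exponent \<epsilon> i \<noteq> 0"
proof -
  \<comment> \<open>The least variable has position 1, so \<open>1 \<le> m\<close> puts its basis
    automorphism into \<open>M\<close>.\<close>
  define i where "i = (Min UNIV :: 'n)"
  have "{j. j \<le> i} = {i}"
    by (auto simp: i_def intro: antisym)
  then have "var_pos i \<le> m"
    using m by (simp add: var_pos_def)
  obtain \<epsilon> where "\<epsilon> \<in> carrier (alg_Aut rf_const UNIV)"
    and \<epsilon>: "\<forall>j. \<epsilon> (rf_var j) = (if j = i then T 1 (rf_var j) else rf_var j)"
    using T_exists by blast
  with \<open>var_pos i \<le> m\<close> have "\<epsilon> \<in> M"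
    unfolding M_eq by (intro generate.incl) auto
  moreover have "exponent \<epsilon> i = 1"
    by (rule exponentI) (simp add: \<epsilon>)
  ultimately show ?thesis
    by (intro bexI[of _ \<epsilon>] exI[of _ i]) auto
qed

text \<open>An exponent vector of maximal Euclidean norm is the unique maximum of the inner product
  with it.\<close>

lemma galois_ring_not_PI:
  assumes setting: "galois_setting rf_const \<Lambda> G M" and U: "galois_ring \<Lambda> G M U"
  shows "\<not> PI_algebra (\<lambda>c. skew_scalar (rf_const c)) ((skew_fixed_ring M G)\<lparr>carrier := U\<rparr>)"
proof -
  interpret galois_setting rf_const \<Lambda> G M by fact
  have Gcar: "g \<in> carrier (alg_Aut rf_const \<Lambda>)" if "g \<in> G" for g
    using subgroup.subset[OF G_subgroup] that by auto
  have G: "field_aut g" "g (rf_const c) = rf_const c" "a \<in> \<Lambda> \<Longrightarrow> g a \<in> \<Lambda>" if "g \<in> G" for g c a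
    using Gcar[OF that] by (auto simp: carrier_alg_Aut)
  have id_G: "id \<in> G"
    using subgroup.one_closed[OF G_subgroup] by simp
  have comp_G: "g \<circ> h \<in> G" if "g \<in> G" "h \<in> G" for g h
    using subgroup.m_closed[OF G_subgroup that] by simp
  have \<Lambda>_add: "a + b \<in> \<Lambda>" if "a \<in> \<Lambda>" "b \<in> \<Lambda>" for a b
    using subgroup.m_closed[OF subring.axioms(1)[OF subring] that] by (simp add: ring_of_type_algebra_def)
  have \<Lambda>_mult: "a * b \<in> \<Lambda>" if "a \<in> \<Lambda>" "b \<in> \<Lambda>" for a b
    using submonoid.m_closed[OF subring.axioms(2)[OF subring] that] by (simp add: ring_of_type_algebra_def)
  have \<Lambda>_const: "rf_const c \<in> \<Lambda>" for c
    using scalars by auto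
  have \<Lambda>_diff: "a - b \<in> \<Lambda>" if "a \<in> \<Lambda>" "b \<in> \<Lambda>" for a b
  proof -
    \<comment> \<open>Subtraction is reduced to sums and products by way of the constant -1.\<close>
    have "rf_const (- 1) + 1 = (0 :: ('n, 'k) ratfun)"
      using rf_const_add[of "- 1" 1] by simp
    then have "rf_const (- 1) = (- 1 :: ('n, 'k) ratfun)"
      by (simp add: eq_neg_iff_add_eq_0)
    then have "a - b = a + rf_const (- 1) * b"
      by simp
    then show ?thesis
      using \<Lambda>_add[OF that(1) \<Lambda>_mult[OF \<Lambda>_const that(2)]] by (simp only:)
  qed
  have \<Lambda>_1: "1 \<in> \<Lambda>"
    using \<Lambda>_const[of 1] by simp
  have inf: "infinite (range (rf_const :: 'k \<Rightarrow> ('n, 'k) ratfun))"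
    using infinite_UNIV_char_0[where 'a = 'k] inj_rf_const finite_imageD by blast
  obtain \<epsilon> i where "\<epsilon> \<in> M" "exponent \<epsilon> i \<noteq> 0"
    using exists_nontrivial_exponent by blast
  then obtain u where "u \<in> U" "\<epsilon> \<in> Poly_Mapping.keys u"
    using galois_ring_support[OF U G_finite id_G G(1) comp_G conj_closed] by blast
  have subring_U: "subring U (skew_fixed_ring M G)" and \<Gamma>U: "skew_scalar ` fixed_points G \<Lambda> \<subseteq> U"
    using U by (auto simp: galois_ring_def Let_def)
  interpret subring U "skew_fixed_ring M G" by fact
  have uM: "Poly_Mapping.keys u \<subseteq> M"
    using \<open>u \<in> U\<close> subset by (auto simp: carrier_skew_fixed_ring)
  define N where "N \<nu> = (\<Sum>j\<in>UNIV. (exponent \<nu> j)\<^sup>2)" for \<nu>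
  obtain \<mu> where \<mu>: "\<mu> \<in> Poly_Mapping.keys u" and N_max: "\<And>\<nu>. \<nu> \<in> Poly_Mapping.keys u \<Longrightarrow> N \<nu> \<le> N \<mu>"
  proof -
    have "finite (N ` Poly_Mapping.keys u)" "N ` Poly_Mapping.keys u \<noteq> {}"
      using \<open>\<epsilon> \<in> Poly_Mapping.keys u\<close> by auto
    then have "Max (N ` Poly_Mapping.keys u) \<in> N ` Poly_Mapping.keys u"
      by (rule Max_in)
    then obtain \<mu> where "\<mu> \<in> Poly_Mapping.keys u" "N \<mu> = Max (N ` Poly_Mapping.keys u)"
      by auto
    then show thesis
      by (intro that[of \<mu>]) auto
  qed
  have "\<mu> \<in> M"
    using \<mu> uM by auto
  have "0 < (exponent \<epsilon> i)\<^sup>2"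
    using \<open>exponent \<epsilon> i \<noteq> 0\<close> by simp
  also have "\<dots> \<le> N \<epsilon>"
    unfolding N_def by (rule member_le_sum) auto
  also have "\<dots> \<le> N \<mu>"
    using \<open>\<epsilon> \<in> Poly_Mapping.keys u\<close> by (rule N_max)
  finally have "0 < N \<mu>" .
  define \<phi> where "\<phi> \<nu> = (\<Sum>j\<in>UNIV. exponent \<mu> j * exponent \<nu> j)" for \<nu>
  \<comment> \<open>As the left side is nonnegative and \<open>N \<nu> \<le> N \<mu>\<close>, it
    follows that \<open>\<phi> \<nu> \<le> N \<mu>\<close>; equality forces the left side to be
    0.\<close>
  have polar: "(\<Sum>j\<in>UNIV. (exponent \<mu> j - exponent \<nu> j)\<^sup>2) = N \<mu> + N \<nu> - 2 * \<phi> \<nu>" for \<nu>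
    by (simp add: N_def \<phi>_def power2_diff sum.distrib sum_subtractf sum_distrib_left mult.assoc)
  have \<phi>_\<mu>: "\<phi> \<mu> = N \<mu>"
    by (simp add: N_def \<phi>_def power2_eq_square)
  obtain j where j: "exponent \<mu> j \<noteq> 0"
    using \<open>0 < N \<mu>\<close> by (force simp: N_def)
  \<comment> \<open>The variable \<open>rf_var j\<close> may lie outside \<open>\<Lambda>\<close>,
    but it is a quotient of two elements of \<open>\<Lambda>\<close>. If both had finite orbits, the
    product of their periods would be a period of the variable, against its nonzero
    exponent.\<close>
  have "\<exists>x\<in>\<Lambda>. \<forall>r>0. (\<mu> ^^ r) x \<noteq> x"
  proof (rule ccontr)
    assume contra: "\<not> ?thesis"
    have "(rf_var j :: ('n, 'k) ratfun) \<in> fractions \<Lambda>"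
      by (simp add: fraction_field)
    then obtain a b where ab: "rf_var j = a / b" "a \<in> \<Lambda>" "b \<in> \<Lambda>"
      by (auto simp: fractions_def)
    have finite_orbit: "\<exists>r>0. (\<mu> ^^ r) y = y" if "y \<in> \<Lambda>" for y
      using contra that by blast
    obtain r r' where r: "0 < r" "0 < r'" "(\<mu> ^^ r) a = a" "(\<mu> ^^ r') b = b"
      using finite_orbit[OF ab(2)] finite_orbit[OF ab(3)] by auto
    then have "(\<mu> ^^ (r * r')) a = a" "(\<mu> ^^ (r * r')) b = b"
      using funpow_fixed_mult[OF r(3), of r'] funpow_fixed_mult[OF r(4), of r] by (simp_all add: mult.commute)
    then have "(\<mu> ^^ (r * r')) (rf_var j) = rf_var j"
      using ab field_aut.divide[OF field_aut_funpow[OF M_aut[OF \<open>\<mu> \<in> M\<close>]]] by metis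
    then have "int (r * r') * exponent \<mu> j = 0"
      unfolding funpow_exponent[OF \<open>\<mu> \<in> M\<close>] by (rule T_free)
    then show False
      using j r by simp
  qed
  then obtain x where "x \<in> \<Lambda>" "\<And>r. 0 < r \<Longrightarrow> (\<mu> ^^ r) x \<noteq> x"
    by blast
  then have "\<exists>\<gamma>\<in>fixed_points G \<Lambda>. \<forall>r>0. (\<mu> ^^ r) \<gamma> \<noteq> \<gamma>"
    by (intro exists_invariant_with_infinite_orbit[where C = "range rf_const"])
      (use G_finite G id_G comp_G \<Lambda>_1 \<Lambda>_mult \<Lambda>_diff inf scalars M_const[OF \<open>\<mu> \<in> M\<close>]
        M_aut[OF \<open>\<mu> \<in> M\<close>] in auto)
  then obtain \<gamma> where \<gamma>: "\<gamma> \<in> fixed_points G \<Lambda>" "\<And>r. 0 < r \<Longrightarrow> (\<mu> ^^ r) \<gamma> \<noteq> \<gamma>"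
    by blast
  show ?thesis
  proof (rule leading_weight_not_PI[where \<phi> = \<phi> and \<Gamma> = "fixed_points G \<Lambda>" and u = u and \<mu> = \<mu> and \<gamma> = \<gamma>])
    show "\<phi> (\<alpha> \<circ> \<beta>) = \<phi> \<alpha> + \<phi> \<beta>" if "\<alpha> \<in> M" "\<beta> \<in> M" for \<alpha> \<beta>
      using that by (simp add: \<phi>_def exponent_comp algebra_simps sum.distrib)
    show "a + b \<in> fixed_points G \<Lambda>" "a * b \<in> fixed_points G \<Lambda>"
      if "a \<in> fixed_points G \<Lambda>" "b \<in> fixed_points G \<Lambda>" for a b
      using that \<Lambda>_add \<Lambda>_mult
      by (auto simp: fixed_points_def field_aut.add[OF G(1)] field_aut.mult[OF G(1)])
    show "range rf_const \<subseteq> fixed_points G \<Lambda>"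
      using \<Lambda>_const G(2) by (auto simp: fixed_points_def)
    fix \<nu> assume \<nu>: "\<nu> \<in> Poly_Mapping.keys u"
    have *: "0 \<le> (\<Sum>j\<in>UNIV. (exponent \<mu> j - exponent \<nu> j)\<^sup>2)"
      by (simp add: sum_nonneg)
    then show "\<phi> \<nu> \<le> \<phi> \<mu>"
      using polar[of \<nu>] N_max[OF \<nu>] \<phi>_\<mu> by linarith
    assume "\<phi> \<nu> = \<phi> \<mu>"
    then have "(\<Sum>j\<in>UNIV. (exponent \<mu> j - exponent \<nu> j)\<^sup>2) = 0"
      using polar[of \<nu>] N_max[OF \<nu>] \<phi>_\<mu> * by linarith
    then have "exponent \<mu> = exponent \<nu>"
      by (simp add: sum_nonneg_eq_0_iff fun_eq_iff)
    then show "\<nu> = \<mu>"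
      using exponent_inject \<nu> uM \<open>\<mu> \<in> M\<close> by auto
  qed (use id_in_M comp_in_M subring_U \<Gamma>U inf M_const[OF \<open>\<mu> \<in> M\<close>] \<open>u \<in> U\<close> \<mu> \<open>0 < N \<mu>\<close> \<phi>_\<mu> \<gamma>
      M_aut[OF \<open>\<mu> \<in> M\<close>] in auto)
qed

end

section \<open>The two concrete actions\<close>

lemma rf_const_of_int_eq_0_iff:
  "(rf_const (of_int k) :: ('n::linorder, 'k::field_char_0) ratfun) = 0 \<longleftrightarrow> k = 0"
  by (metis of_int_eq_0_iff rf_const_0 rf_const_eq_iff)

lemma rf_var_neq_0: "(rf_var j :: ('n::linorder, 'k::field) ratfun) \<noteq> 0"
proof
  assume "(rf_var j :: ('n, 'k) ratfun) = 0"
  then have "Poly_Mapping.single (Poly_Mapping.single j 1) (1::'k) = (0 :: ('n \<Rightarrow>\<^sub>0 nat) \<Rightarrow>\<^sub>0 'k)"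
    by (simp add: rf_var_def Zero_fract_def eq_fract)
  from arg_cong[OF this, of "\<lambda>p. Poly_Mapping.lookup p (Poly_Mapping.single j 1)"] show False
    by simp
qed

lemma basis_action_shift:
  assumes "1 \<le> m"
  shows "basis_action (\<lambda>k x. x - rf_const (of_int k))
    (shift_group m :: (('n::{finite, linorder}, 'k::field_char_0) ratfun \<Rightarrow> _) set) m"
proof
  fix \<sigma> :: "('n, 'k) ratfun \<Rightarrow> ('n, 'k) ratfun" and k x
  assume \<sigma>: "field_aut \<sigma>" "\<And>c. \<sigma> (rf_const c) = rf_const c"
  show "\<sigma> (x - rf_const (of_int k)) = \<sigma> x - rf_const (of_int k)"
    using \<sigma> by (simp add: field_aut.diff)
next
  fix i :: 'n
  define h :: "'k \<Rightarrow> 'n \<Rightarrow> ('n \<Rightarrow>\<^sub>0 nat) \<Rightarrow>\<^sub>0 'k" where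
    "h c j = (if j = i then mpoly_var j + mpoly_const c else mpoly_var j)" for c j
  \<comment> \<open>Translations by \<open>c\<close> and \<open>- c\<close> are mutually inverse;
    the case \<open>c = - 1\<close> is the basis automorphism.\<close>
  have "mpoly_subst (h c) (h (- c) j) = mpoly_var j" for c j
    by (simp add: h_def mpoly_subst_add mpoly_subst_var mpoly_subst_const add.assoc flip: single_add)
  from this[of 1] this[of "- 1"]
  obtain \<epsilon> where \<epsilon>: "\<epsilon> \<in> carrier (alg_Aut rf_const UNIV)" "\<And>j. \<epsilon> (rf_var j) = Fract (h (- 1) j) 1"
    using exists_ratfun_aut[of "h (- 1)" "h 1"] by auto
  have "\<epsilon> (rf_var j) = (if j = i then rf_var j - rf_const (of_int 1) else rf_var j)" for j
    unfolding \<epsilon>(2) by (simp add: h_def rf_var_def mpoly_var_def One_fract_def single_uminus)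
  with \<epsilon>(1) show "\<exists>\<epsilon>\<in>carrier (alg_Aut rf_const UNIV).
      \<forall>j. \<epsilon> (rf_var j) = (if j = i then rf_var j - rf_const (of_int 1) else rf_var j :: ('n, 'k) ratfun)"
    by blast
qed (use assms in \<open>simp_all add: shift_group_def rf_const_add algebra_simps rf_const_of_int_eq_0_iff\<close>)

lemma basis_action_qshift:
  fixes q :: "'k::field_char_0"
  assumes "1 \<le> m" and q: "q \<noteq> 0" "\<forall>r::nat. 0 < r \<longrightarrow> q ^ r \<noteq> 1"
  shows "basis_action (\<lambda>k x. rf_const (q powi k) * x)
    (qshift_group q m :: (('n::{finite, linorder}, 'k) ratfun \<Rightarrow> _) set) m"
proof
  fix \<sigma> :: "('n, 'k) ratfun \<Rightarrow> ('n, 'k) ratfun" and k x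
  assume \<sigma>: "field_aut \<sigma>" "\<And>c. \<sigma> (rf_const c) = rf_const c"
  show "\<sigma> (rf_const (q powi k) * x) = rf_const (q powi k) * \<sigma> x"
    using \<sigma> by (simp add: field_aut.mult)
next
  fix k and j :: 'n
  assume "rf_const (q powi k) * rf_var j = (rf_var j :: ('n, 'k) ratfun)"
  then have "(rf_const (q powi k) :: ('n, 'k) ratfun) = rf_const 1"
    by (simp add: rf_var_neq_0)
  then have "q powi k = 1"
    by (simp only: rf_const_eq_iff)
  \<comment> \<open>A negative power is the inverse of a positive one, so the absolute value brings
    the condition on roots of unity into play.\<close>
  then have "q ^ nat \<bar>k\<bar> = 1"
    by (auto simp: power_int_def power_inverse split: if_splits)
  then show "k = 0"
    using q(2)[rule_format, of "nat \<bar>k\<bar>"] by (cases "k = 0") auto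
next
  fix i :: 'n
  define h :: "'k \<Rightarrow> 'n \<Rightarrow> ('n \<Rightarrow>\<^sub>0 nat) \<Rightarrow>\<^sub>0 'k" where
    "h c j = (if j = i then mpoly_const c * mpoly_var j else mpoly_var j)" for c j
  \<comment> \<open>Dilations by mutually inverse factors are mutually inverse; they are used for
    \<open>q\<close> and its inverse.\<close>
  have "mpoly_subst (h c) (h d j) = mpoly_var j" if "c * d = 1" for c d j
  proof -
    have "mpoly_const d * (mpoly_const c * mpoly_var i) = mpoly_const (d * c) * (mpoly_var i :: ('n \<Rightarrow>\<^sub>0 nat) \<Rightarrow>\<^sub>0 'k)"
      by (simp only: mpoly_const_mult mult.assoc)
    also have "d * c = 1"
      using that by (simp only: mult.commute)
    finally have "mpoly_const d * (mpoly_const c * mpoly_var i) = (mpoly_var i :: ('n \<Rightarrow>\<^sub>0 nat) \<Rightarrow>\<^sub>0 'k)"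
      by (simp only: single_one mult_1)
    then show ?thesis
      by (simp add: h_def mpoly_subst_mult mpoly_subst_var mpoly_subst_const)
  qed
  from this[of q "inverse q"] this[of "inverse q" q]
  obtain \<epsilon> where \<epsilon>: "\<epsilon> \<in> carrier (alg_Aut rf_const UNIV)" "\<And>j. \<epsilon> (rf_var j) = Fract (h q j) 1"
    using exists_ratfun_aut[of "h q" "h (inverse q)"] q(1) by auto
  have "\<epsilon> (rf_var j) = (if j = i then rf_const (q powi 1) * rf_var j else rf_var j)" for j
    unfolding \<epsilon>(2) by (simp add: h_def rf_var_def rf_const_def mpoly_var_def)
  with \<epsilon>(1) show "\<exists>\<epsilon>\<in>carrier (alg_Aut rf_const UNIV).
      \<forall>j. \<epsilon> (rf_var j) = (if j = i then rf_const (q powi 1) * rf_var j else rf_var j :: ('n, 'k) ratfun)"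
    by blast
qed (use assms in \<open>simp_all add: qshift_group_def rf_const_mult power_int_add mult.assoc\<close>)

text \<open>The carrier remembers \<open>M\<close> through its basis elements
  \<open>Poly_Mapping.single \<mu> 1\<close>, so an equality of skew rings identifies the acting
  monoids.\<close>

lemma skew_monoid_ring_inject:
  assumes "skew_monoid_ring M = (skew_monoid_ring M' :: (('l \<Rightarrow> 'l) \<Rightarrow>\<^sub>0 'l::field) ring)"
  shows "M = M'"
proof -
  have mem: "\<mu> \<in> N \<longleftrightarrow> Poly_Mapping.single \<mu> 1 \<in> carrier (skew_monoid_ring N :: (('l \<Rightarrow> 'l) \<Rightarrow>\<^sub>0 'l) ring)" for \<mu> N
    by (simp add: skew_monoid_ring_def)
  show ?thesis
  proof (rule Set.set_eqI)
    show "\<mu> \<in> M \<longleftrightarrow> \<mu> \<in> M'" for \<mu>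
      using mem[of \<mu> M] mem[of \<mu> M'] assms by (simp only:)
  qed
qed

theorem theorem4p9:
  fixes \<Lambda> :: "('n::{finite, linorder}, 'k::field_char_0) ratfun set"
    and G M :: "(('n, 'k) ratfun \<Rightarrow> ('n, 'k) ratfun) set"
    and U :: "((('n, 'k) ratfun \<Rightarrow> ('n, 'k) ratfun) \<Rightarrow>\<^sub>0 ('n, 'k) ratfun) set"
    and m :: nat
  assumes "1 \<le> m" and "m \<le> CARD('n)"
    and "galois_setting rf_const \<Lambda> G M"
    and "skew_monoid_ring M = S_alg m \<or>
         (\<exists>q :: 'k. q \<noteq> 0 \<and> (\<forall>r::nat. 0 < r \<longrightarrow> q ^ r \<noteq> 1) \<and> skew_monoid_ring M = Q_alg q m)"
    and "galois_ring \<Lambda> G M U"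
  shows "\<not> PI_algebra (\<lambda>c. skew_scalar (rf_const c)) ((skew_fixed_ring M G)\<lparr>carrier := U\<rparr>)"
  using assms(4)
proof (elim disjE exE conjE)
  assume "skew_monoid_ring M = S_alg m"
  then have "M = shift_group m"
    unfolding S_alg_def by (rule skew_monoid_ring_inject)
  then show ?thesis
    using basis_action.galois_ring_not_PI[OF basis_action_shift[OF assms(1)]] assms(3,5) by metis
next
  fix q :: 'k
  assume q: "q \<noteq> 0" "\<forall>r::nat. 0 < r \<longrightarrow> q ^ r \<noteq> 1" and "skew_monoid_ring M = Q_alg q m"
  then have "M = qshift_group q m"
    unfolding Q_alg_def by (intro skew_monoid_ring_inject)
  then show ?thesis
    using basis_action.galois_ring_not_PI[OF basis_action_qshift[OF assms(1) q]] assms(3,5) by metis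
qed

end
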